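(* Let $(E,\omega)$ be an LV-graph and $R$ a domain. Then $L_R(E,\omega)$ is a nonsingular ring (i.e. both right and left nonsingular).
   Context: A weighted graph $(E,\omega)$, $E=(E^0,E^{\mathrm{st}},E^1,s,r,\omega)$, consists of countable sets $E^0$ (vertices), $E^{\mathrm{st}}$ (structured edges), $E^1$ (edges), maps $s,r:E^{\mathrm{st}}\to E^0$ and a weight map $\omega:E^{\mathrm{st}}\to\mathbb N=\{1,2,\dots\}$ such that $E^1=\bigsqcup_{\alpha\in E^{\mathrm{st}}}\{\alpha_1,\dots,\alpha_{\omega(\alpha)}\}$. All weighted graphs are assumed row-finite: $s^{-1}(v)\subseteq E^{\mathrm{st}}$ is finite for every $v\in E^0$. A vertex $v$ is a sink if $s^{-1}(v)=\emptyset$; if $v$ is not a sink, $\omega(v):=\max\{\omega(\alpha)\mid\alpha\in s^{-1}(v)\}$. Rings of coefficients $R$ are unital. Let $(E^1)^*=\{\alpha_i^*\mid\alpha_i\in E^1\}$, $X=E^0\cup E^1\cup(E^1)^*$, and let $R\langle X\rangle$ be the free (non-unital) $R$-ring on $X$: the free left $R$-module on the nonempty words over $X$ with multiplication $(\sum r_xx)(\sum s_yy)=\sum r_xs_y\,xy$. The weighted Leavitt path algebra $L_R(E,\omega)$ is the quotient of $R\langle X\rangle$ by the ideal generated by the relations: (1) $vw=\delta_{vw}v$ for $v,w\in E^0$; (2) $s(\alpha)\alpha_i=\alpha_ir(\alpha)=\alpha_i$ and $r(\alpha)\alpha_i^*=\alpha_i^*s(\alpha)=\alpha_i^*$ for $\alpha\in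 E^{\mathrm{st}}$, $1\le i\le\omega(\alpha)$; (3) $\sum_{\alpha\in s^{-1}(v)}\alpha_i\alpha_j^*=\delta_{ij}v$ for every non-sink $v$ and $1\le i,j\le\omega(v)$; (4) $\sum_{1\le i\le\max\{\omega(\alpha),\omega(\beta)\}}\alpha_i^*\beta_i=\delta_{\alpha\beta}r(\alpha)$ for all $\alpha,\beta\in E^{\mathrm{st}}$; where in (3) and (4) $\alpha_i:=\alpha_i^*:=0$ whenever $i>\omega(\alpha)$. A generalised path is a single vertex $v$ (with $s(v)=r(v)=v$) or a word $x_1\cdots x_n$, $n\ge1$, $x_i\in E^1\cup(E^1)^*$ with $r(x_i)=s(x_{i+1})$, going from $s(x_1)$ to $r(x_n)$, where $s(\alpha_i)=s(\alpha)$, $r(\alpha_i)=r(\alpha)$, $s(\alpha_i^* )=r(\alpha)$, $r(\alpha_i^* )=s(\alpha)$. An LV-graph is a weighted graph such that $\omega(\alpha)\ge2$ for all $\alpha\in E^{\mathrm{st}}$; $|\{\alpha\in s^{-1}(v)\mid\omega(\alpha)=\omega(v)\}|\ge2$ for every non-sink $v\in E^0$; $E^{\mathrm{st}}\ne\emptyset$; and $(E,\omega)$ is connected, i.e. for any $u,v\in E^0$ there is a generalised path from $u$ to $v$. The algebra $L_R(E,\omega)$ has local units but need not be unital. A ring $A$ is right nonsingular if for no nonzero $a\in A$ the right annihilator $\{b\in A\mid ab=0\}$ is an essential right ideal; left nonsingular is defined symmetrically. *)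

theory Defs
  imports "HOL-Algebra.QuotRing" "HOL-Library.Poly_Mapping" "HOL-Library.Countable_Set"
    "Graph_Theory.Digraph"
begin

section \<open>Nonsingular rings\<close>

text \<open>
  Rings are not assumed to be unital, so the locale \<^locale>\<open>ring\<close> cannot be used. We keep the
  record type of HOL-Algebra; its field for the unit is never referred to.
\<close>

locale nonunital_ring = abelian_group A for A (structure) +
  assumes m_closed: "\<lbrakk>x \<in> carrier A; y \<in> carrier A\<rbrakk> \<Longrightarrow> x \<otimes> y \<in> carrier A"
    and m_assoc: "\<lbrakk>x \<in> carrier A; y \<in> carrier A; z \<in> carrier A\<rbrakk>
      \<Longrightarrow> (x \<otimes> y) \<otimes> z = x \<otimes> (y \<otimes> z)"
    and l_distr: "\<lbrakk>x \<in> carrier A; y \<in> carrier A; z \<in> carrier A\<rbrakk>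
      \<Longrightarrow> (x \<oplus> y) \<otimes> z = x \<otimes> z \<oplus> y \<otimes> z"
    and r_distr: "\<lbrakk>x \<in> carrier A; y \<in> carrier A; z \<in> carrier A\<rbrakk>
      \<Longrightarrow> z \<otimes> (x \<oplus> y) = z \<otimes> x \<oplus> z \<otimes> y"

definition right_ideal :: "'a set \<Rightarrow> ('a, 'm) ring_scheme \<Rightarrow> bool" where
  "right_ideal I A \<longleftrightarrow>
     additive_subgroup I A \<and> (\<forall>x\<in>I. \<forall>a\<in>carrier A. x \<otimes>\<^bsub>A\<^esub> a \<in> I)"

definition left_ideal :: "'a set \<Rightarrow> ('a, 'm) ring_scheme \<Rightarrow> bool" where
  "left_ideal I A \<longleftrightarrow>
     additive_subgroup I A \<and> (\<forall>x\<in>I. \<forall>a\<in>carrier A. a \<otimes>\<^bsub>A\<^esub> x \<in> I)"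

definition essential_right_ideal :: "'a set \<Rightarrow> ('a, 'm) ring_scheme \<Rightarrow> bool" where
  "essential_right_ideal I A \<longleftrightarrow>
     right_ideal I A \<and> (\<forall>J. right_ideal J A \<and> J \<noteq> {\<zero>\<^bsub>A\<^esub>} \<longrightarrow> I \<inter> J \<noteq> {\<zero>\<^bsub>A\<^esub>})"

definition essential_left_ideal :: "'a set \<Rightarrow> ('a, 'm) ring_scheme \<Rightarrow> bool" where
  "essential_left_ideal I A \<longleftrightarrow>
     left_ideal I A \<and> (\<forall>J. left_ideal J A \<and> J \<noteq> {\<zero>\<^bsub>A\<^esub>} \<longrightarrow> I \<inter> J \<noteq> {\<zero>\<^bsub>A\<^esub>})"

definition right_annihilator :: "('a, 'm) ring_scheme \<Rightarrow> 'a \<Rightarrow> 'a set" where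
  "right_annihilator A a = {b \<in> carrier A. a \<otimes>\<^bsub>A\<^esub> b = \<zero>\<^bsub>A\<^esub>}"

definition left_annihilator :: "('a, 'm) ring_scheme \<Rightarrow> 'a \<Rightarrow> 'a set" where
  "left_annihilator A a = {b \<in> carrier A. b \<otimes>\<^bsub>A\<^esub> a = \<zero>\<^bsub>A\<^esub>}"

definition right_nonsingular :: "('a, 'm) ring_scheme \<Rightarrow> bool" where
  "right_nonsingular A \<longleftrightarrow>
     (\<forall>a\<in>carrier A. a \<noteq> \<zero>\<^bsub>A\<^esub> \<longrightarrow> \<not> essential_right_ideal (right_annihilator A a) A)"

definition left_nonsingular :: "('a, 'm) ring_scheme \<Rightarrow> bool" where
  "left_nonsingular A \<longleftrightarrow>
     (\<forall>a\<in>carrier A. a \<noteq> \<zero>\<^bsub>A\<^esub> \<longrightarrow> \<not> essential_left_ideal (left_annihilator A a) A)"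

definition nonsingular_ring :: "('a, 'm) ring_scheme \<Rightarrow> bool" where
  "nonsingular_ring A \<longleftrightarrow> nonunital_ring A \<and> right_nonsingular A \<and> left_nonsingular A"


section \<open>The free non-unital ring on a set\<close>

text \<open>
  The type \<^typ>\<open>'x list \<Rightarrow>\<^sub>0 'r\<close> is the free module on all words. Since
  \<^typ>\<open>'x list\<close> is not of class \<^class>\<open>monoid_add\<close>, it does not carry the product of
  \<^theory>\<open>HOL-Library.Poly_Mapping\<close>, so the concatenation product is defined here.
\<close>

definition word_mult ::
    "('x list \<Rightarrow>\<^sub>0 'r::ring_1) \<Rightarrow> ('x list \<Rightarrow>\<^sub>0 'r) \<Rightarrow> ('x list \<Rightarrow>\<^sub>0 'r)"
    (infixl \<open>\<star>\<close> 70) where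
  "f \<star> g = (\<Sum>u\<in>Poly_Mapping.keys f. \<Sum>v\<in>Poly_Mapping.keys g.
      Poly_Mapping.single (u @ v) (Poly_Mapping.lookup f u * Poly_Mapping.lookup g v))"

definition word_scale :: "'r::ring_1 \<Rightarrow> ('x list \<Rightarrow>\<^sub>0 'r) \<Rightarrow> ('x list \<Rightarrow>\<^sub>0 'r)" where
  "word_scale c f = Poly_Mapping.map (\<lambda>x. c * x) f"

text \<open>The empty word is excluded, so this ring has no unit.\<close>

definition free_ring :: "'x set \<Rightarrow> ('x list \<Rightarrow>\<^sub>0 'r::ring_1) ring" where
  "free_ring X =
     \<lparr>carrier = {f. \<forall>w\<in>Poly_Mapping.keys f. w \<noteq> [] \<and> w \<in> lists X},
      mult = (\<star>), one = undefined, zero = 0, add = (+)\<rparr>"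

text \<open>
  Ideals are closed under scalars, so that quotients are again modules over the coefficients. This
  does not follow from the closure under products because the free ring has no unit.
\<close>

definition free_ring_ideal :: "'x set \<Rightarrow> ('x list \<Rightarrow>\<^sub>0 'r::ring_1) set \<Rightarrow> bool" where
  "free_ring_ideal X I \<longleftrightarrow>
     left_ideal I (free_ring X) \<and> right_ideal I (free_ring X) \<and> (\<forall>c. \<forall>f\<in>I. word_scale c f \<in> I)"


section \<open>Weighted graphs\<close>

text \<open>
  The arcs of \<open>E\<close> are the structured edges, \<^const>\<open>tail\<close> is the source map and
  \<^const>\<open>head\<close> the range map. The edges are the pairs of a structured edge \<open>\<alpha>\<close> and an
  index from 1 to \<open>\<omega> \<alpha>\<close>.
\<close>

locale weighted_graph = wf_digraph E for E :: "('v, 'e) pre_digraph" and \<omega> :: "'e \<Rightarrow> nat" +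
  assumes countable_verts: "countable (verts E)"
    and countable_arcs: "countable (arcs E)"
    and weight_pos: "\<alpha> \<in> arcs E \<Longrightarrow> 1 \<le> \<omega> \<alpha>"
    and row_finite: "v \<in> verts E \<Longrightarrow> finite (out_arcs E v)"

definition is_sink :: "('v, 'e) pre_digraph \<Rightarrow> 'v \<Rightarrow> bool" where
  "is_sink E v \<longleftrightarrow> out_arcs E v = {}"

definition vertex_weight :: "('v, 'e) pre_digraph \<Rightarrow> ('e \<Rightarrow> nat) \<Rightarrow> 'v \<Rightarrow> nat" where
  "vertex_weight E \<omega> v = Max (\<omega> ` out_arcs E v)"

text \<open>\<open>Edge \<alpha> i\<close> stands for $\alpha_i$ and \<open>Ghost \<alpha> i\<close> for $\alpha_i^*$.\<close>

datatype ('v, 'e) letter = Vertex 'v | Edge 'e nat | Ghost 'e nat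

definition edge_letters :: "('v, 'e) pre_digraph \<Rightarrow> ('e \<Rightarrow> nat) \<Rightarrow> ('v, 'e) letter set" where
  "edge_letters E \<omega> = {Edge \<alpha> i |\<alpha> i. \<alpha> \<in> arcs E \<and> 1 \<le> i \<and> i \<le> \<omega> \<alpha>}"

definition ghost_letters :: "('v, 'e) pre_digraph \<Rightarrow> ('e \<Rightarrow> nat) \<Rightarrow> ('v, 'e) letter set" where
  "ghost_letters E \<omega> = {Ghost \<alpha> i |\<alpha> i. \<alpha> \<in> arcs E \<and> 1 \<le> i \<and> i \<le> \<omega> \<alpha>}"

definition letters :: "('v, 'e) pre_digraph \<Rightarrow> ('e \<Rightarrow> nat) \<Rightarrow> ('v, 'e) letter set" where
  "letters E \<omega> = Vertex ` verts E \<union> edge_letters E \<omega> \<union> ghost_letters E \<omega>"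

fun letter_source :: "('v, 'e) pre_digraph \<Rightarrow> ('v, 'e) letter \<Rightarrow> 'v" where
  "letter_source E (Vertex v) = v"
| "letter_source E (Edge \<alpha> i) = tail E \<alpha>"
| "letter_source E (Ghost \<alpha> i) = head E \<alpha>"

fun letter_range :: "('v, 'e) pre_digraph \<Rightarrow> ('v, 'e) letter \<Rightarrow> 'v" where
  "letter_range E (Vertex v) = v"
| "letter_range E (Edge \<alpha> i) = head E \<alpha>"
| "letter_range E (Ghost \<alpha> i) = tail E \<alpha>"

definition generalised_path ::
    "('v, 'e) pre_digraph \<Rightarrow> ('e \<Rightarrow> nat) \<Rightarrow> ('v, 'e) letter list \<Rightarrow> bool" where
  "generalised_path E \<omega> p \<longleftrightarrow>
     (\<exists>v\<in>verts E. p = [Vertex v]) \<or>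
     (p \<noteq> [] \<and> set p \<subseteq> edge_letters E \<omega> \<union> ghost_letters E \<omega> \<and>
      (\<forall>i. Suc i < length p \<longrightarrow> letter_range E (p ! i) = letter_source E (p ! Suc i)))"

definition weighted_graph_connected :: "('v, 'e) pre_digraph \<Rightarrow> ('e \<Rightarrow> nat) \<Rightarrow> bool" where
  "weighted_graph_connected E \<omega> \<longleftrightarrow>
     (\<forall>u\<in>verts E. \<forall>v\<in>verts E. \<exists>p. generalised_path E \<omega> p \<and>
        letter_source E (hd p) = u \<and> letter_range E (last p) = v)"

locale LV_graph = weighted_graph E \<omega> for E :: "('v, 'e) pre_digraph" and \<omega> :: "'e \<Rightarrow> nat" +
  assumes weight_ge_2: "\<alpha> \<in> arcs E \<Longrightarrow> 2 \<le> \<omega> \<alpha>"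
    and max_weight_arcs: "\<lbrakk>v \<in> verts E; \<not> is_sink E v\<rbrakk>
      \<Longrightarrow> 2 \<le> card {\<alpha> \<in> out_arcs E v. \<omega> \<alpha> = vertex_weight E \<omega> v}"
    and arcs_nonempty: "arcs E \<noteq> {}"
    and weighted_connected: "weighted_graph_connected E \<omega>"


section \<open>Weighted Leavitt path algebras\<close>

definition vertex_elem :: "'v \<Rightarrow> (('v, 'e) letter list \<Rightarrow>\<^sub>0 'r::ring_1)" where
  "vertex_elem v = Poly_Mapping.single [Vertex v] 1"

text \<open>The convention is that $\alpha_i = \alpha_i^* = 0$ if \<open>i\<close> exceeds the weight.\<close>

definition edge_elem :: "('e \<Rightarrow> nat) \<Rightarrow> 'e \<Rightarrow> nat \<Rightarrow> (('v, 'e) letter list \<Rightarrow>\<^sub>0 'r::ring_1)" where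
  "edge_elem \<omega> \<alpha> i = (if i \<le> \<omega> \<alpha> then Poly_Mapping.single [Edge \<alpha> i] 1 else 0)"

definition ghost_elem :: "('e \<Rightarrow> nat) \<Rightarrow> 'e \<Rightarrow> nat \<Rightarrow> (('v, 'e) letter list \<Rightarrow>\<^sub>0 'r::ring_1)" where
  "ghost_elem \<omega> \<alpha> i = (if i \<le> \<omega> \<alpha> then Poly_Mapping.single [Ghost \<alpha> i] 1 else 0)"

text \<open>A relation $x = y$ is represented by the difference $x - y$.\<close>

inductive_set leavitt_relations ::
    "('v, 'e) pre_digraph \<Rightarrow> ('e \<Rightarrow> nat) \<Rightarrow> (('v, 'e) letter list \<Rightarrow>\<^sub>0 'r::ring_1) set"
  for E :: "('v, 'e) pre_digraph" and \<omega> :: "'e \<Rightarrow> nat" where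
  vertices: "\<lbrakk>v \<in> verts E; w \<in> verts E\<rbrakk> \<Longrightarrow>
    vertex_elem v \<star> vertex_elem w - (if v = w then vertex_elem v else 0)
      \<in> leavitt_relations E \<omega>"
| edge_source: "\<lbrakk>\<alpha> \<in> arcs E; 1 \<le> i; i \<le> \<omega> \<alpha>\<rbrakk> \<Longrightarrow>
    vertex_elem (tail E \<alpha>) \<star> edge_elem \<omega> \<alpha> i - edge_elem \<omega> \<alpha> i \<in> leavitt_relations E \<omega>"
| edge_range: "\<lbrakk>\<alpha> \<in> arcs E; 1 \<le> i; i \<le> \<omega> \<alpha>\<rbrakk> \<Longrightarrow>
    edge_elem \<omega> \<alpha> i \<star> vertex_elem (head E \<alpha>) - edge_elem \<omega> \<alpha> i \<in> leavitt_relations E \<omega>"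
| ghost_source: "\<lbrakk>\<alpha> \<in> arcs E; 1 \<le> i; i \<le> \<omega> \<alpha>\<rbrakk> \<Longrightarrow>
    vertex_elem (head E \<alpha>) \<star> ghost_elem \<omega> \<alpha> i - ghost_elem \<omega> \<alpha> i \<in> leavitt_relations E \<omega>"
| ghost_range: "\<lbrakk>\<alpha> \<in> arcs E; 1 \<le> i; i \<le> \<omega> \<alpha>\<rbrakk> \<Longrightarrow>
    ghost_elem \<omega> \<alpha> i \<star> vertex_elem (tail E \<alpha>) - ghost_elem \<omega> \<alpha> i \<in> leavitt_relations E \<omega>"
| edge_ghost: "\<lbrakk>v \<in> verts E; \<not> is_sink E v; i \<in> {1..vertex_weight E \<omega> v};
      j \<in> {1..vertex_weight E \<omega> v}\<rbrakk> \<Longrightarrow>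
    (\<Sum>\<alpha>\<in>out_arcs E v. edge_elem \<omega> \<alpha> i \<star> ghost_elem \<omega> \<alpha> j)
      - (if i = j then vertex_elem v else 0) \<in> leavitt_relations E \<omega>"
| ghost_edge: "\<lbrakk>\<alpha> \<in> arcs E; \<beta> \<in> arcs E\<rbrakk> \<Longrightarrow>
    (\<Sum>i=1..max (\<omega> \<alpha>) (\<omega> \<beta>). ghost_elem \<omega> \<alpha> i \<star> edge_elem \<omega> \<beta> i)
      - (if \<alpha> = \<beta> then vertex_elem (head E \<alpha>) else 0) \<in> leavitt_relations E \<omega>"

definition leavitt_ideal ::
    "('v, 'e) pre_digraph \<Rightarrow> ('e \<Rightarrow> nat) \<Rightarrow> (('v, 'e) letter list \<Rightarrow>\<^sub>0 'r::ring_1) set" where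
  "leavitt_ideal E \<omega> = free_ring_ideal (letters E \<omega>) hull leavitt_relations E \<omega>"

definition weighted_leavitt_path_algebra ::
    "('v, 'e) pre_digraph \<Rightarrow> ('e \<Rightarrow> nat) \<Rightarrow> (('v, 'e) letter list \<Rightarrow>\<^sub>0 'r::ring_1) set ring" where
  "weighted_leavitt_path_algebra E \<omega> = free_ring (letters E \<omega>) Quot leavitt_ideal E \<omega>"

end

theory Submission
  imports Defs
begin

text \<open>
  Solving relations (3) and (4) for one word of length 2 each, namely \<open>\<alpha>\<^sub>i\<alpha>\<^sub>j\<^sup>*\<close> for a chosen arc of
  maximal weight at its source and \<open>\<alpha>\<^sub>1\<^sup>*\<beta>\<^sub>1\<close>, gives normal words. Appending a letter to a normal
  word needs at most one reduction, so the algebra acts on the free module on the normal words by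
  an explicit formula, and the kernel of this action is the ideal of relations. Comparing
  coefficients of words of maximal length shows that \<open>fg \<noteq> 0\<close> whenever \<open>f = fv \<noteq> 0\<close> and
  \<open>g = vg \<noteq> 0\<close> for a vertex \<open>v\<close>. If \<open>a \<noteq> 0\<close>, then \<open>av \<noteq> 0\<close> for some vertex \<open>v\<close>, and the right
  annihilator of \<open>a\<close> meets the right ideal generated by \<open>v\<close> only in 0.
\<close>

section \<open>Additive maps on finitely supported functions\<close>

text \<open>The eliminated words are chosen so that a rewriting never disturbs its neighbours.
  Rewriting an edge-ghost pair changes the arc and keeps the indices; rewriting a ghost-edge pair
  changes the index and keeps the arcs. An adjacent letter can form a forbidden word only of the
  other kind, and that kind is recognised by exactly the data that were kept. Hence one rewriting
  per appended letter suffices, and only two overlaps remain, \<open>\<gamma>\<^sub>1\<^sup>*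
  \<alpha>\<^sub>1 \<alpha>\<^sub>j\<^sup>*\<close> and
  \<open>\<alpha>\<^sub>k \<alpha>\<^sub>1\<^sup>* \<beta>\<^sub>1\<close> with \<alpha> a chosen
  arc; both are settled by exchanging two finite sums. The obstacle in the product argument is that
  several pairs of longest words can contribute to the same word. One needs a word reached from a
  single pair: its coefficient is then plus or minus a product of two nonzero coefficients.
  Coefficients need not commute with each other, so left and right scalars are kept apart
  throughout.\<close>

lemma poly_mapping_eq_sum_single:
  "f = (\<Sum>k\<in>Poly_Mapping.keys f. Poly_Mapping.single k (Poly_Mapping.lookup f k))"
  by (rule poly_mapping_eqI)
    (auto simp: lookup_sum lookup_single when_def sum.delta' in_keys_iff)

text \<open>The standard reduction to monomials below. Agreement is required only on the support of
  \<open>f\<close>, because several congruences hold only for words of a special shape.\<close>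

lemma additive_eq_on_singles:
  fixes F G :: "('k \<Rightarrow>\<^sub>0 'a::ab_group_add) \<Rightarrow> 'b::ab_group_add"
  assumes "additive F" "additive G"
    and "\<And>k c. k \<in> Poly_Mapping.keys f \<Longrightarrow> F (Poly_Mapping.single k c) = G (Poly_Mapping.single k c)"
  shows "F f = G f"
proof -
  have "F f = (\<Sum>k\<in>Poly_Mapping.keys f. F (Poly_Mapping.single k (Poly_Mapping.lookup f k)))"
    by (subst poly_mapping_eq_sum_single) (rule additive.sum[OF assms(1)])
  also have "\<dots> = (\<Sum>k\<in>Poly_Mapping.keys f. G (Poly_Mapping.single k (Poly_Mapping.lookup f k)))"
    using assms(3) by (intro sum.cong) auto
  also have "\<dots> = G f"
    by (subst (3) poly_mapping_eq_sum_single) (rule additive.sum[OF assms(2), symmetric])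
  finally show ?thesis .
qed

lemma sum_keys_superset:
  assumes "finite S" "Poly_Mapping.keys f \<subseteq> S" "\<And>k. F k 0 = 0"
  shows "(\<Sum>k\<in>Poly_Mapping.keys f. F k (Poly_Mapping.lookup f k))
    = (\<Sum>k\<in>S. F k (Poly_Mapping.lookup f k))"
  by (rule sum.mono_neutral_left) (use assms in \<open>auto simp: in_keys_iff\<close>)

text \<open>The support of a sum can shrink by cancellation, so all three sums are first extended to
  the union of the two supports. The product of words and the actions below are all sums of this
  form.\<close>

lemma additive_sum_keys:
  fixes F :: "'k \<Rightarrow> 'a::ab_group_add \<Rightarrow> 'b::ab_group_add"
  assumes "\<And>k. additive (F k)"
  shows "additive (\<lambda>f. \<Sum>k\<in>Poly_Mapping.keys f. F k (Poly_Mapping.lookup f k))"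
proof
  fix f g :: "'k \<Rightarrow>\<^sub>0 'a"
  let ?S = "Poly_Mapping.keys f \<union> Poly_Mapping.keys g"
  have 0: "F k 0 = 0" for k
    using assms by (rule additive.zero)
  have "(\<Sum>k\<in>Poly_Mapping.keys (f + g). F k (Poly_Mapping.lookup (f + g) k))
      = (\<Sum>k\<in>?S. F k (Poly_Mapping.lookup (f + g) k))"
    by (rule sum_keys_superset) (use keys_add[of f g] 0 in auto)
  also have "\<dots> = (\<Sum>k\<in>?S. F k (Poly_Mapping.lookup f k)) + (\<Sum>k\<in>?S. F k (Poly_Mapping.lookup g k))"
    by (simp add: lookup_add additive.add[OF assms] sum.distrib)
  also have
    "(\<Sum>k\<in>?S. F k (Poly_Mapping.lookup f k))
      = (\<Sum>k\<in>Poly_Mapping.keys f. F k (Poly_Mapping.lookup f k))"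
    by (rule sum_keys_superset[symmetric]) (use 0 in auto)
  also have
    "(\<Sum>k\<in>?S. F k (Poly_Mapping.lookup g k))
      = (\<Sum>k\<in>Poly_Mapping.keys g. F k (Poly_Mapping.lookup g k))"
    by (rule sum_keys_superset[symmetric]) (use 0 in auto)
  finally show "(\<Sum>k\<in>Poly_Mapping.keys (f + g). F k (Poly_Mapping.lookup (f + g) k)) =
    (\<Sum>k\<in>Poly_Mapping.keys f. F k (Poly_Mapping.lookup f k)) +
    (\<Sum>k\<in>Poly_Mapping.keys g. F k (Poly_Mapping.lookup g k))" .
qed

lemma additive_compose: "additive F \<Longrightarrow> additive G \<Longrightarrow> additive (\<lambda>x. F (G x))"
  by (simp add: additive_def)

lemma additive_fun_sum: "(\<And>i. i \<in> S \<Longrightarrow> additive (F i)) \<Longrightarrow> additive (\<lambda>x. \<Sum>i\<in>S. F i x)"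
  by (simp add: additive_def sum.distrib)

lemma additive_single: "additive (Poly_Mapping.single k)"
  by unfold_locales (rule single_add)

section \<open>The free ring\<close>

lemma lookup_word_scale [simp]:
  "Poly_Mapping.lookup (word_scale c f) k = c * Poly_Mapping.lookup f k"
  by (simp add: word_scale_def map.rep_eq when_def)

lemma word_scale_single [simp]:
  "word_scale c (Poly_Mapping.single k d) = Poly_Mapping.single k (c * d)"
  by (rule poly_mapping_eqI) (simp add: lookup_single when_def)

lemma word_scale_zero [simp]: "word_scale c 0 = 0"
  by (rule poly_mapping_eqI) simp

lemma word_scale_zero_left [simp]: "word_scale 0 f = 0"
  by (rule poly_mapping_eqI) simp

lemma word_scale_one [simp]: "word_scale 1 f = f"
  by (rule poly_mapping_eqI) simp

lemma word_scale_word_scale: "word_scale c (word_scale d f) = word_scale (c * d) f"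
  by (rule poly_mapping_eqI) (simp add: mult.assoc)

lemma word_scale_diff: "word_scale c (f - g) = word_scale c f - word_scale c g"
  by (rule poly_mapping_eqI) (simp add: lookup_minus algebra_simps)

lemma additive_word_scale: "additive (word_scale c)"
  by unfold_locales (rule poly_mapping_eqI, simp add: lookup_add distrib_left)

lemma additive_word_scale_left: "additive (\<lambda>c. word_scale c f)"
  by unfold_locales (rule poly_mapping_eqI, simp add: lookup_add distrib_right)

lemma keys_word_scale: "Poly_Mapping.keys (word_scale c f) \<subseteq> Poly_Mapping.keys f"
  by (auto simp: in_keys_iff)

text \<open>Coefficients commute with letters but not with one another, so the coefficients of a
  right factor have to be multiplied on from the right.\<close>

definition word_scale_right :: "('x list \<Rightarrow>\<^sub>0 'r::ring_1) \<Rightarrow> 'r \<Rightarrow> ('x list \<Rightarrow>\<^sub>0 'r)" where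
  "word_scale_right f c = Poly_Mapping.map (\<lambda>x. x * c) f"

lemma lookup_word_scale_right [simp]:
  "Poly_Mapping.lookup (word_scale_right f c) k = Poly_Mapping.lookup f k * c"
  by (simp add: word_scale_right_def map.rep_eq when_def)

lemma word_scale_right_single [simp]:
  "word_scale_right (Poly_Mapping.single k d) c = Poly_Mapping.single k (d * c)"
  by (rule poly_mapping_eqI) (simp add: lookup_single when_def)

lemma word_scale_right_one [simp]: "word_scale_right f 1 = f"
  by (rule poly_mapping_eqI) simp

lemma word_scale_right_word_scale_right:
  "word_scale_right (word_scale_right f c) d = word_scale_right f (c * d)"
  by (rule poly_mapping_eqI) (simp add: mult.assoc)

lemma word_scale_right_word_scale:
  "word_scale_right (word_scale c f) d = word_scale c (word_scale_right f d)"
  by (rule poly_mapping_eqI) (simp add: mult.assoc)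

lemma additive_word_scale_right: "additive (\<lambda>f. word_scale_right f c)"
  by unfold_locales (rule poly_mapping_eqI, simp add: lookup_add distrib_right)

lemma additive_word_scale_right_scalar: "additive (word_scale_right f)"
  by unfold_locales (rule poly_mapping_eqI, simp add: lookup_add distrib_left)

lemma keys_word_scale_right: "Poly_Mapping.keys (word_scale_right f c) \<subseteq> Poly_Mapping.keys f"
  by (auto simp: in_keys_iff)

lemma additive_mult_left: "additive (\<lambda>x. x * (d::'r::ring_1))"
  and additive_mult_right: "additive (\<lambda>x. (d::'r::ring_1) * x)"
  by unfold_locales (auto simp: algebra_simps)

lemma additive_word_mult_left: "additive (\<lambda>f. f \<star> g)"
  unfolding word_mult_def
  by (intro additive_sum_keys additive_fun_sum)
    (rule additive_compose[OF additive_single additive_mult_left])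

lemma additive_word_mult_right: "additive (\<lambda>g. f \<star> g)"
  unfolding word_mult_def
  by (intro additive_fun_sum additive_sum_keys)
    (rule additive_compose[OF additive_single additive_mult_right])

lemmas word_mult_zero_left [simp] = additive.zero[OF additive_word_mult_left]
lemmas word_mult_zero_right [simp] = additive.zero[OF additive_word_mult_right]
lemmas word_mult_add_left = additive.add[OF additive_word_mult_left]
lemmas word_mult_add_right = additive.add[OF additive_word_mult_right]
lemmas word_mult_diff_left = additive.diff[OF additive_word_mult_left]
lemmas word_mult_diff_right = additive.diff[OF additive_word_mult_right]
lemmas word_mult_sum_right = additive.sum[OF additive_word_mult_right]

lemma word_mult_single [simp]:
  "Poly_Mapping.single u c \<star> Poly_Mapping.single v d = Poly_Mapping.single (u @ v) (c * d)"
  by (simp add: word_mult_def)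

lemma word_mult_assoc:
  fixes f g h :: "'x list \<Rightarrow>\<^sub>0 'r::ring_1"
  shows "(f \<star> g) \<star> h = f \<star> (g \<star> h)"
proof (rule additive_eq_on_singles[where f = f and F = "\<lambda>f. (f \<star> g) \<star> h" and G = "\<lambda>f. f \<star> (g \<star> h)"])
  fix u :: "'x list" and c :: 'r
  let ?s = "Poly_Mapping.single u c"
  show "(?s \<star> g) \<star> h = ?s \<star> (g \<star> h)"
  proof (rule additive_eq_on_singles[where f = g and F = "\<lambda>g. (?s \<star> g) \<star> h"
    and G = "\<lambda>g. ?s \<star> (g \<star> h)"])
    fix v :: "'x list" and d :: 'r
    let ?t = "Poly_Mapping.single v d"
    show "(?s \<star> ?t) \<star> h = ?s \<star> (?t \<star> h)"
      by (rule additive_eq_on_singles[where f = h and F = "\<lambda>h. (?s \<star> ?t) \<star> h"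
        and G = "\<lambda>h. ?s \<star> (?t \<star> h)"])
        (simp_all add: mult.assoc additive_def word_mult_add_right)
  qed (simp_all add: additive_def word_mult_add_right word_mult_add_left)
qed (simp_all add: additive_def word_mult_add_left)

lemma keys_word_mult:
  assumes "w \<in> Poly_Mapping.keys (f \<star> g)"
  obtains u v where "u \<in> Poly_Mapping.keys f" "v \<in> Poly_Mapping.keys g" "w = u @ v"
proof -
  have "w \<in> (\<Union>u\<in>Poly_Mapping.keys f. \<Union>v\<in>Poly_Mapping.keys g. {u @ v})"
    using assms unfolding word_mult_def
    by (fastforce dest!: subsetD[OF keys_sum] split: if_splits)
  then show ?thesis using that by auto
qed

abbreviation free_carrier :: "'x set \<Rightarrow> ('x list \<Rightarrow>\<^sub>0 'r::ring_1) set" where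
  "free_carrier X \<equiv> carrier (free_ring X)"

lemma free_carrier_iff: "f \<in> free_carrier X \<longleftrightarrow> Poly_Mapping.keys f \<subseteq> lists X - {[]}"
  by (auto simp: free_ring_def)

lemma free_ring_simps [simp]:
  "mult (free_ring X) = (\<star>)" "zero (free_ring X) = 0" "add (free_ring X) = (+)"
  by (simp_all add: free_ring_def)

lemma free_carrier_add: "f \<in> free_carrier X \<Longrightarrow> g \<in> free_carrier X \<Longrightarrow> f + g \<in> free_carrier X"
  using keys_add[of f g] unfolding free_carrier_iff by blast

lemma free_carrier_diff: "f \<in> free_carrier X \<Longrightarrow> g \<in> free_carrier X \<Longrightarrow> f - g \<in> free_carrier X"
  using keys_diff[of f g] unfolding free_carrier_iff by blast

lemma free_carrier_uminus: "f \<in> free_carrier X \<Longrightarrow> - f \<in> free_carrier X"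
  unfolding free_carrier_iff by simp

lemma free_carrier_zero: "0 \<in> free_carrier X"
  unfolding free_carrier_iff by simp

lemma free_carrier_mult: "f \<in> free_carrier X \<Longrightarrow> g \<in> free_carrier X \<Longrightarrow> f \<star> g \<in> free_carrier X"
  unfolding free_carrier_iff by (fastforce elim: keys_word_mult)

lemma free_carrier_scale: "f \<in> free_carrier X \<Longrightarrow> word_scale c f \<in> free_carrier X"
  unfolding free_carrier_iff using keys_word_scale by fast

lemma free_carrier_sum: "(\<And>i. i \<in> S \<Longrightarrow> F i \<in> free_carrier X) \<Longrightarrow> sum F S \<in> free_carrier X"
  by (induction S rule: infinite_finite_induct) (auto simp: free_carrier_zero free_carrier_add)

lemma free_carrier_single: "u \<in> lists X \<Longrightarrow> u \<noteq> [] \<Longrightarrow> Poly_Mapping.single u c \<in> free_carrier X"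
  unfolding free_carrier_iff by simp

lemma nonunital_ring_free_ring: "nonunital_ring (free_ring X)"
proof (rule nonunital_ring.intro)
  show "abelian_group (free_ring X)"
    by (rule abelian_groupI)
      (auto simp: free_carrier_add free_carrier_zero add_ac
        intro: bexI[of _ "- x" for x] free_carrier_uminus)
  show "nonunital_ring_axioms (free_ring X)"
    by unfold_locales
      (auto simp: free_carrier_mult word_mult_assoc word_mult_add_left word_mult_add_right)
qed

lemma a_inv_free_ring: "f \<in> free_carrier X \<Longrightarrow> a_inv (free_ring X) f = - f"
proof -
  interpret nonunital_ring "free_ring X" by (rule nonunital_ring_free_ring)
  assume "f \<in> free_carrier X"
  then show ?thesis
    by (intro minus_equality) (auto simp: free_carrier_uminus)
qed

lemma additive_subgroup_free_ring_iff:
  "additive_subgroup J (free_ring X) \<longleftrightarrow>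
     J \<subseteq> free_carrier X \<and> 0 \<in> J \<and> (\<forall>f\<in>J. \<forall>g\<in>J. f - g \<in> J)" (is "?L \<longleftrightarrow> ?R")
proof
  interpret nonunital_ring "free_ring X" by (rule nonunital_ring_free_ring)
  assume ?L
  then interpret additive_subgroup J "free_ring X" .
  have "f - g \<in> J" if "f \<in> J" "g \<in> J" for f g
  proof -
    have "a_inv (free_ring X) g \<in> J"
      using that additive_subgroup.a_subgroup[OF \<open>?L\<close>] subgroup.m_inv_closed a_inv_def by metis
    then show ?thesis
      using that a_closed[of f "a_inv (free_ring X) g"] a_Hcarr[of g] by (simp add: a_inv_free_ring)
  qed
  then show ?R
    using a_subset zero_closed by auto
next
  interpret nonunital_ring "free_ring X" by (rule nonunital_ring_free_ring)
  assume R: ?R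
  have neg: "- f \<in> J" if "f \<in> J" for f
    using R that by (metis diff_0)
  have add: "f + g \<in> J" if "f \<in> J" "g \<in> J" for f g
    using R that neg by (metis diff_minus_eq_add)
  have inv: "inv\<^bsub>add_monoid (free_ring X)\<^esub> f = - f" if "f \<in> J" for f
    using a_inv_free_ring[of f X] R that by (auto simp: a_inv_def)
  show ?L
    by (rule additive_subgroup.intro, rule subgroup.intro)
      (use R neg add inv in auto)
qed

lemma free_ring_ideal_iff:
  "free_ring_ideal X J \<longleftrightarrow>
     J \<subseteq> free_carrier X \<and> 0 \<in> J \<and> (\<forall>f\<in>J. \<forall>g\<in>J. f - g \<in> J) \<and>
     (\<forall>f\<in>J. \<forall>g\<in>free_carrier X. f \<star> g \<in> J \<and> g \<star> f \<in> J) \<and> (\<forall>c. \<forall>f\<in>J. word_scale c f \<in> J)"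
  unfolding free_ring_ideal_def left_ideal_def right_ideal_def additive_subgroup_free_ring_iff
  by auto

text \<open>The hull is an intersection of ideals. The assumption makes the whole carrier one of
  them, which keeps the intersection inside the carrier.\<close>

lemma free_ring_ideal_hull:
  fixes S :: "('x list \<Rightarrow>\<^sub>0 'r::ring_1) set"
  assumes "S \<subseteq> free_carrier X"
  shows "free_ring_ideal X (free_ring_ideal X hull S)"
proof -
  have "free_ring_ideal X (free_carrier X :: ('x list \<Rightarrow>\<^sub>0 'r::ring_1) set)"
    unfolding free_ring_ideal_iff
    by (auto simp: free_carrier_zero free_carrier_diff free_carrier_mult free_carrier_scale)
  then have "free_ring_ideal X hull S \<subseteq> free_carrier X"
    using assms by (rule hull_minimal[rotated])
  moreover have "0 \<in> free_ring_ideal X hull S"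
    by (auto simp: hull_def free_ring_ideal_iff)
  ultimately show ?thesis
    unfolding free_ring_ideal_iff
    by (auto simp: hull_def free_ring_ideal_iff)
qed

section \<open>Nonsingularity and quotients\<close>

context nonunital_ring
begin

lemma l_null [simp]: "x \<in> carrier A \<Longrightarrow> \<zero> \<otimes> x = \<zero>"
  using l_distr[of \<zero> \<zero> x] m_closed[of \<zero> x] add.l_cancel_one'[of "\<zero> \<otimes> x" "\<zero> \<otimes> x"] by auto

lemma r_null [simp]: "x \<in> carrier A \<Longrightarrow> x \<otimes> \<zero> = \<zero>"
  using r_distr[of \<zero> \<zero> x] m_closed[of x \<zero>] add.l_cancel_one'[of "x \<otimes> \<zero>" "x \<otimes> \<zero>"] by auto

lemma l_minus: "x \<in> carrier A \<Longrightarrow> y \<in> carrier A \<Longrightarrow> (\<ominus> x) \<otimes> y = \<ominus> (x \<otimes> y)"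
  using l_distr[of "\<ominus> x" x y] by (intro minus_equality[symmetric]) (auto simp: m_closed l_neg)

lemma r_minus: "x \<in> carrier A \<Longrightarrow> y \<in> carrier A \<Longrightarrow> x \<otimes> (\<ominus> y) = \<ominus> (x \<otimes> y)"
  using r_distr[of "\<ominus> y" y x] by (intro minus_equality[symmetric]) (auto simp: m_closed l_neg)

lemma right_ideal_principal:
  assumes "e \<in> carrier A"
  shows "right_ideal ((\<otimes>) e ` carrier A) A"
  unfolding right_ideal_def
proof (intro conjI ballI)
  show "additive_subgroup ((\<otimes>) e ` carrier A) A"
  proof (intro additive_subgroup.intro add.subgroupI)
    fix x y assume "x \<in> (\<otimes>) e ` carrier A" "y \<in> (\<otimes>) e ` carrier A"
    then show "x \<oplus> y \<in> (\<otimes>) e ` carrier A"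
      using assms by (auto simp: r_distr[symmetric])
  qed (use assms in \<open>auto simp: m_closed r_minus[symmetric]\<close>)
next
  fix x a assume "x \<in> (\<otimes>) e ` carrier A" "a \<in> carrier A"
  then show "x \<otimes> a \<in> (\<otimes>) e ` carrier A"
    using assms by (auto simp: m_closed m_assoc)
qed

lemma left_ideal_principal:
  assumes "e \<in> carrier A"
  shows "left_ideal ((\<lambda>x. x \<otimes> e) ` carrier A) A"
  unfolding left_ideal_def
proof (intro conjI ballI)
  show "additive_subgroup ((\<lambda>x. x \<otimes> e) ` carrier A) A"
  proof (intro additive_subgroup.intro add.subgroupI)
    fix x y assume "x \<in> (\<lambda>x. x \<otimes> e) ` carrier A" "y \<in> (\<lambda>x. x \<otimes> e) ` carrier A"
    then show "x \<oplus> y \<in> (\<lambda>x. x \<otimes> e) ` carrier A"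
      using assms by (auto simp: l_distr[symmetric])
  qed (use assms in \<open>auto simp: m_closed l_minus[symmetric]\<close>)
next
  fix x a assume "x \<in> (\<lambda>x. x \<otimes> e) ` carrier A" "a \<in> carrier A"
  then show "a \<otimes> x \<in> (\<lambda>x. x \<otimes> e) ` carrier A"
    using assms by (auto simp: m_closed m_assoc[symmetric])
qed

text \<open>The condition \<open>nz\<close> is symmetric in left and right, so one family of
  idempotents and one product statement serve both halves; only the existence of a local unit is
  asked for on each side.\<close>

lemma nonsingular_ringI:
  assumes carr: "V \<subseteq> carrier A"
    and idem: "\<And>e. e \<in> V \<Longrightarrow> e \<otimes> e = e"
    and right_unit: "\<And>a. a \<in> carrier A \<Longrightarrow> a \<noteq> \<zero> \<Longrightarrow> \<exists>e\<in>V. a \<otimes> e \<noteq> \<zero>"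
    and left_unit: "\<And>a. a \<in> carrier A \<Longrightarrow> a \<noteq> \<zero> \<Longrightarrow> \<exists>e\<in>V. e \<otimes> a \<noteq> \<zero>"
    and nz: "\<And>a b e. a \<in> carrier A \<Longrightarrow> b \<in> carrier A \<Longrightarrow> e \<in> V \<Longrightarrow> a \<otimes> e \<noteq> \<zero> \<Longrightarrow> e \<otimes> b \<noteq> \<zero>
      \<Longrightarrow> (a \<otimes> e) \<otimes> (e \<otimes> b) \<noteq> \<zero>"
  shows "nonsingular_ring A"
  unfolding nonsingular_ring_def
proof (intro conjI)
  show "nonunital_ring A" ..
  have mult: "(a \<otimes> e) \<otimes> (e \<otimes> b) = a \<otimes> (e \<otimes> b)" "(a \<otimes> e) \<otimes> (e \<otimes> b) = (a \<otimes> e) \<otimes> b"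
    if "a \<in> carrier A" "b \<in> carrier A" "e \<in> V" for a b e
  proof -
    have e: "e \<in> carrier A" using that carr by auto
    then have "e \<otimes> (e \<otimes> b) = e \<otimes> b"
      using that by (simp add: m_assoc[symmetric] idem)
    then show "(a \<otimes> e) \<otimes> (e \<otimes> b) = a \<otimes> (e \<otimes> b)"
      using that e by (simp add: m_assoc m_closed)
    then show "(a \<otimes> e) \<otimes> (e \<otimes> b) = (a \<otimes> e) \<otimes> b"
      using that e by (simp add: m_assoc)
  qed
  show "right_nonsingular A"
    unfolding right_nonsingular_def
  proof (intro ballI impI notI)
    fix a assume a: "a \<in> carrier A" "a \<noteq> \<zero>"
      and ess: "essential_right_ideal (right_annihilator A a) A"
    obtain e where e: "e \<in> V" "a \<otimes> e \<noteq> \<zero>" using right_unit[OF a] by auto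
    have ec: "e \<in> carrier A" using carr e by auto
    let ?J = "(\<otimes>) e ` carrier A"
    have "e \<noteq> \<zero>" using e a by auto
    \<comment> \<open>Without a unit in the ring, it is idempotence that puts e into the ideal that
      it generates.\<close>
    then have "?J \<noteq> {\<zero>}" using idem[OF e(1)] ec by force
    moreover have "right_annihilator A a \<inter> ?J = {\<zero>}"
    proof (intro equalityI subsetI)
      fix x assume "x \<in> right_annihilator A a \<inter> ?J"
      then obtain y where "y \<in> carrier A" "x = e \<otimes> y" "a \<otimes> x = \<zero>"
        by (auto simp: right_annihilator_def)
      then show "x \<in> {\<zero>}" using nz[OF a(1) _ e] mult[OF a(1) _ e(1)] by auto
    next
      fix x assume "x \<in> {\<zero>}"
      then show "x \<in> right_annihilator A a \<inter> ?J"
        using a ec by (auto simp: right_annihilator_def intro!: image_eqI[of _ _ \<zero>])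
    qed
    ultimately show False
      using ess right_ideal_principal[OF ec] unfolding essential_right_ideal_def by blast
  qed
  show "left_nonsingular A"
    unfolding left_nonsingular_def
  proof (intro ballI impI notI)
    fix a assume a: "a \<in> carrier A" "a \<noteq> \<zero>" and ess: "essential_left_ideal (left_annihilator A a) A"
    obtain e where e: "e \<in> V" "e \<otimes> a \<noteq> \<zero>" using left_unit[OF a] by auto
    have ec: "e \<in> carrier A" using carr e by auto
    let ?J = "(\<lambda>x. x \<otimes> e) ` carrier A"
    have "e \<noteq> \<zero>" using e a by auto
    then have "?J \<noteq> {\<zero>}" using idem[OF e(1)] ec by force
    moreover have "left_annihilator A a \<inter> ?J = {\<zero>}"
    proof (intro equalityI subsetI)
      fix x assume "x \<in> left_annihilator A a \<inter> ?J"
      then obtain y where "y \<in> carrier A" "x = y \<otimes> e" "x \<otimes> a = \<zero>"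
        by (auto simp: left_annihilator_def)
      then show "x \<in> {\<zero>}" using nz[OF _ a(1) e(1) _ e(2)] mult[OF _ a(1) e(1)] by auto
    next
      fix x assume "x \<in> {\<zero>}"
      then show "x \<in> left_annihilator A a \<inter> ?J"
        using a ec by (auto simp: left_annihilator_def intro!: image_eqI[of _ _ \<zero>])
    qed
    ultimately show False
      using ess left_ideal_principal[OF ec] unfolding essential_left_ideal_def by blast
  qed
qed

end

locale two_sided_ideal = nonunital_ring A + abelian_subgroup I A for I and A (structure) +
  assumes I_l: "x \<in> I \<Longrightarrow> a \<in> carrier A \<Longrightarrow> a \<otimes> x \<in> I"
    and I_r: "x \<in> I \<Longrightarrow> a \<in> carrier A \<Longrightarrow> x \<otimes> a \<in> I"
begin

text \<open>The product of two cosets is the union of the cosets of all products of representatives.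
  These cosets coincide, since changing representatives changes the product by an element of I, by
  absorption on both sides.\<close>

lemma coset_mult:
  assumes "x \<in> carrier A" "y \<in> carrier A"
  shows "[mod I:] (I +> x) \<Otimes> (I +> y) = I +> (x \<otimes> y)"
proof -
  have "I +> (h \<oplus> x) \<otimes> (k \<oplus> y) = I +> x \<otimes> y" if "h \<in> I" "k \<in> I" for h k
  proof (rule a_repr_independence'[symmetric])
    have hk: "h \<in> carrier A" "k \<in> carrier A" using that by auto
    have "(h \<oplus> x) \<otimes> (k \<oplus> y) = (h \<otimes> (k \<oplus> y) \<oplus> x \<otimes> k) \<oplus> x \<otimes> y"
      using assms hk by (simp add: l_distr r_distr m_closed a_ac)
    moreover have "h \<otimes> (k \<oplus> y) \<oplus> x \<otimes> k \<in> I"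
      using that assms hk
        by (intro additive_subgroup.a_closed[OF additive_subgroup_axioms] I_l I_r) auto
    ultimately show "(h \<oplus> x) \<otimes> (k \<oplus> y) \<in> I +> x \<otimes> y"
      by (auto simp: a_r_coset_def')
  qed (use assms in \<open>auto simp: m_closed\<close>)
  moreover have "I \<noteq> {}" using zero_closed by blast
  ultimately show ?thesis
    using assms unfolding rcoset_mult_def a_r_coset_def'[of _ I x] a_r_coset_def'[of _ I y]
    by auto
qed

lemma quotient_carrierE:
  assumes "x \<in> carrier (A Quot I)"
  obtains a where "a \<in> carrier A" "x = I +> a"
  using assms by (auto simp: FactRing_simps)

lemma quotient_simps [simp]:
  "a \<in> carrier A \<Longrightarrow> I +> a \<in> carrier (A Quot I)"
  "\<zero>\<^bsub>A Quot I\<^esub> = I"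
  "a \<in> carrier A \<Longrightarrow> b \<in> carrier A \<Longrightarrow> (I +> a) \<otimes>\<^bsub>A Quot I\<^esub> (I +> b) = I +> a \<otimes> b"
  "a \<in> carrier A \<Longrightarrow> b \<in> carrier A \<Longrightarrow> (I +> a) \<oplus>\<^bsub>A Quot I\<^esub> (I +> b) = I +> (a \<oplus> b)"
  by (auto simp: FactRing_simps coset_mult a_rcos_sum)

lemma coset_eq_ideal_iff: "a \<in> carrier A \<Longrightarrow> I +> a = I \<longleftrightarrow> a \<in> I"
  using a_coset_join2[of a I] a_rcos_self[of a] a_subgroup by auto

lemma nonunital_ring_quotient: "nonunital_ring (A Quot I)"
proof (rule nonunital_ring.intro)
  show "abelian_group (A Quot I)"
    by (rule comm_group_abelian_groupI)
      (simp add: FactRing_def a_factorgroup_is_comm_group[unfolded A_FactGroup_def'])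
  show "nonunital_ring_axioms (A Quot I)"
    by unfold_locales
      (auto elim!: quotient_carrierE simp: m_closed m_assoc l_distr r_distr)
qed

end

lemma two_sided_ideal_free_ring:
  assumes "free_ring_ideal X J"
  shows "two_sided_ideal J (free_ring X)"
proof -
  interpret nonunital_ring "free_ring X" by (rule nonunital_ring_free_ring)
  have "additive_subgroup J (free_ring X)"
    using assms by (simp add: free_ring_ideal_def left_ideal_def)
  then have "abelian_subgroup J (free_ring X)"
    by (intro abelian_subgroupI3) (auto intro: abelian_group_axioms)
  then interpret abelian_subgroup J "free_ring X" .
  show ?thesis
    by unfold_locales (use assms in \<open>auto simp: free_ring_ideal_iff\<close>)
qed

section \<open>Normal words and the reduction action\<close>

abbreviation word :: "'x list \<Rightarrow> ('x list \<Rightarrow>\<^sub>0 'r::ring_1)" where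
  "word w \<equiv> Poly_Mapping.single w 1"

context LV_graph
begin

text \<open>Maximal weight matters: the term of this arc is then present in relation (3) for all i
  and j up to \<omega>(v), so the relation can always be solved for it.\<close>

definition special :: "'v \<Rightarrow> 'e" where
  "special v = (SOME \<alpha>. \<alpha> \<in> out_arcs E v \<and> \<omega> \<alpha> = vertex_weight E \<omega> v)"

lemma weight_le_vertex_weight: "\<alpha> \<in> arcs E \<Longrightarrow> \<omega> \<alpha> \<le> vertex_weight E \<omega> (tail E \<alpha>)"
  unfolding vertex_weight_def by (rule Max_ge) (auto intro!: row_finite)

text \<open>At least two arcs attain the maximal weight, so any one arc can be avoided. Avoiding the
  chosen arc later provides a replacement word for every forbidden edge-ghost word.\<close>

lemma max_weight_arc_exists:
  assumes "v \<in> verts E" "\<not> is_sink E v"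
  obtains \<gamma> where "\<gamma> \<in> out_arcs E v" "\<omega> \<gamma> = vertex_weight E \<omega> v" "\<gamma> \<noteq> \<beta>"
proof -
  have "\<not> {\<alpha> \<in> out_arcs E v. \<omega> \<alpha> = vertex_weight E \<omega> v} \<subseteq> {\<beta>}"
  proof
    assume "{\<alpha> \<in> out_arcs E v. \<omega> \<alpha> = vertex_weight E \<omega> v} \<subseteq> {\<beta>}"
    then have "card {\<alpha> \<in> out_arcs E v. \<omega> \<alpha> = vertex_weight E \<omega> v} \<le> card {\<beta>}"
      by (rule card_mono[rotated]) simp
    then show False using max_weight_arcs[OF assms] by simp
  qed
  then show ?thesis using that by auto
qed

lemma special:
  assumes "v \<in> verts E" "\<not> is_sink E v"
  shows "special v \<in> arcs E" "tail E (special v) = v" "\<omega> (special v) = vertex_weight E \<omega> v"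
proof -
  have "\<exists>\<alpha>. \<alpha> \<in> out_arcs E v \<and> \<omega> \<alpha> = vertex_weight E \<omega> v"
    using max_weight_arc_exists[OF assms] by metis
  from someI_ex[OF this, folded special_def]
  show "special v \<in> arcs E" "tail E (special v) = v" "\<omega> (special v) = vertex_weight E \<omega> v"
    by auto
qed

lemma not_sink_tail: "\<alpha> \<in> arcs E \<Longrightarrow> \<not> is_sink E (tail E \<alpha>)"
  by (auto simp: is_sink_def)

section \<open>Letters, forbidden words of length 2 and their replacements\<close>

definition arrow_letters :: "('v, 'e) letter set" where
  "arrow_letters = edge_letters E \<omega> \<union> ghost_letters E \<omega>"

lemma arrow_letters_simps [simp]:
  "Vertex v \<notin> arrow_letters"
  "Edge \<alpha> i \<in> arrow_letters \<longleftrightarrow> \<alpha> \<in> arcs E \<and> 1 \<le> i \<and> i \<le> \<omega> \<alpha>"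
  "Ghost \<alpha> i \<in> arrow_letters \<longleftrightarrow> \<alpha> \<in> arcs E \<and> 1 \<le> i \<and> i \<le> \<omega> \<alpha>"
  by (auto simp: arrow_letters_def edge_letters_def ghost_letters_def)

lemma letters_eq: "letters E \<omega> = Vertex ` verts E \<union> arrow_letters"
  by (auto simp: letters_def arrow_letters_def)

lemma letter_source_in_verts: "y \<in> letters E \<omega> \<Longrightarrow> letter_source E y \<in> verts E"
  and letter_range_in_verts: "y \<in> letters E \<omega> \<Longrightarrow> letter_range E y \<in> verts E"
  by (cases y; auto simp: letters_eq)+

text \<open>Index 1 occurs on every arc, so relation (4) always contains the term
  \<open>\<alpha>\<^sub>1\<^sup>*\<beta>\<^sub>1\<close> and can be solved for it. Matching of range
  and source is imposed separately, in \<open>composable\<close>.\<close>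

fun forbidden :: "('v, 'e) letter \<Rightarrow> ('v, 'e) letter \<Rightarrow> bool" where
  "forbidden (Edge \<alpha> i) (Ghost \<beta> j) \<longleftrightarrow> \<alpha> = \<beta> \<and> \<alpha> = special (tail E \<alpha>)"
| "forbidden (Ghost \<alpha> i) (Edge \<beta> j) \<longleftrightarrow> i = 1 \<and> j = 1"
| "forbidden _ _ \<longleftrightarrow> False"

text \<open>
  Relations (3) and (4), solved for the forbidden word \<open>xy\<close>, rewrite it to minus the sum of the
  words in \<open>replacements x y\<close>, plus a vertex if \<open>cancels x y\<close>.
\<close>

fun replacements ::
  "('v, 'e) letter \<Rightarrow> ('v, 'e) letter \<Rightarrow> (('v, 'e) letter \<times> ('v, 'e) letter) set" where
  "replacements (Edge \<alpha> i) (Ghost \<beta> j) =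
     (\<lambda>\<gamma>. (Edge \<gamma> i, Ghost \<gamma> j)) ` {\<gamma> \<in> out_arcs E (tail E \<alpha>) - {\<alpha>}. i \<le> \<omega> \<gamma> \<and> j \<le> \<omega> \<gamma>}"
| "replacements (Ghost \<alpha> i) (Edge \<beta> j) =
     (\<lambda>k. (Ghost \<alpha> k, Edge \<beta> k)) ` {k \<in> {2..\<omega> \<alpha>}. k \<le> \<omega> \<beta>}"
| "replacements _ _ = {}"

fun cancels :: "('v, 'e) letter \<Rightarrow> ('v, 'e) letter \<Rightarrow> bool" where
  "cancels (Edge \<alpha> i) (Ghost \<beta> j) \<longleftrightarrow> i = j"
| "cancels (Ghost \<alpha> i) (Edge \<beta> j) \<longleftrightarrow> \<alpha> = \<beta>"
| "cancels _ _ \<longleftrightarrow> False"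

text \<open>Here \<open>q\<close> is the word standing before the pair \<open>x y\<close>. A vertex
  coming from relation (3) or (4) is absorbed by \<open>q\<close>, so that term is
  \<open>word q\<close> rather than \<open>q\<close> followed by a vertex letter.\<close>

definition reduct ::
    "('v, 'e) letter list \<Rightarrow> ('v, 'e) letter \<Rightarrow> ('v, 'e) letter \<Rightarrow> (('v, 'e) letter list \<Rightarrow>\<^sub>0 'r::ring_1)" where
  "reduct q x y = (if cancels x y then word q else 0)
     - (\<Sum>(x', y')\<in>replacements x y. word (q @ [x', y']))"

text \<open>What may precede an edge depends on its index and not on its arc. For a ghost it is the
  reverse: only the arc counts, as the next lemma shows.\<close>

lemma forbidden_Edge_iff: "forbidden x (Edge \<alpha> i) \<longleftrightarrow> i = 1 \<and> (\<exists>\<gamma>. x = Ghost \<gamma> 1)"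
  by (cases x) auto

lemma forbidden_Ghost_iff: "forbidden x (Ghost \<alpha> i) \<longleftrightarrow> \<alpha> = special (tail E \<alpha>) \<and> (\<exists>k. x = Edge \<alpha> k)"
  by (cases x) auto

lemma finite_replacements:
  assumes "x \<in> arrow_letters"
  shows "finite (replacements x y)"
  using assms row_finite
    by (cases "(x, y)" rule: replacements.cases) (auto simp del: in_out_arcs_conv)

text \<open>The weight conditions are moved from the index set into the summand, which makes the
  index set independent of i and j; sums over arcs and over indices can then be exchanged.\<close>

lemma reduct_Edge_Ghost:
  assumes "\<alpha> \<in> arcs E"
  shows "(reduct q (Edge \<alpha> i) (Ghost \<beta> j) :: (('v, 'e) letter list \<Rightarrow>\<^sub>0 'r::ring_1))
    = (if i = j then word q else 0)
    - (\<Sum>\<gamma>\<in>out_arcs E (tail E \<alpha>) - {\<alpha>}.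
        if i \<le> \<omega> \<gamma> \<and> j \<le> \<omega> \<gamma> then word (q @ [Edge \<gamma> i, Ghost \<gamma> j]) else 0)"
proof -
  have "finite (out_arcs E (tail E \<alpha>) - {\<alpha>})"
    using assms row_finite by simp
  then have "(\<Sum>\<gamma>\<in>{\<gamma> \<in> out_arcs E (tail E \<alpha>) - {\<alpha>}. i \<le> \<omega> \<gamma> \<and> j \<le> \<omega> \<gamma>}.
        word (q @ [Edge \<gamma> i, Ghost \<gamma> j]) :: _ \<Rightarrow>\<^sub>0 'r::ring_1)
      = (\<Sum>\<gamma>\<in>out_arcs E (tail E \<alpha>) - {\<alpha>}.
        if i \<le> \<omega> \<gamma> \<and> j \<le> \<omega> \<gamma> then word (q @ [Edge \<gamma> i, Ghost \<gamma> j]) else 0)"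
    by (rule sum.inter_filter)
  moreover have
    "(\<Sum>(x', y')\<in>replacements (Edge \<alpha> i) (Ghost \<beta> j). word (q @ [x', y']) :: _ \<Rightarrow>\<^sub>0 'r::ring_1)
      = (\<Sum>\<gamma>\<in>{\<gamma> \<in> out_arcs E (tail E \<alpha>) - {\<alpha>}. i \<le> \<omega> \<gamma> \<and> j \<le> \<omega> \<gamma>}. word (q @ [Edge \<gamma> i, Ghost \<gamma> j]))"
    unfolding replacements.simps by (subst sum.reindex) (auto simp: inj_on_def)
  ultimately show ?thesis by (simp add: reduct_def)
qed

lemma reduct_Ghost_Edge:
  "(reduct q (Ghost \<alpha> i) (Edge \<beta> j) :: (('v, 'e) letter list \<Rightarrow>\<^sub>0 'r::ring_1)) =
    (if \<alpha> = \<beta> then word q else 0)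
    - (\<Sum>k=2..\<omega> \<alpha>. if k \<le> \<omega> \<beta> then word (q @ [Ghost \<alpha> k, Edge \<beta> k]) else 0)"
proof -
  have "(\<Sum>(x', y')\<in>replacements (Ghost \<alpha> i) (Edge \<beta> j). word (q @ [x', y']) :: _ \<Rightarrow>\<^sub>0 'r::ring_1)
      = (\<Sum>k\<in>{k \<in> {2..\<omega> \<alpha>}. k \<le> \<omega> \<beta>}. word (q @ [Ghost \<alpha> k, Edge \<beta> k]))"
    unfolding replacements.simps by (subst sum.reindex) (auto simp: inj_on_def)
  also have "\<dots> = (\<Sum>k=2..\<omega> \<alpha>. if k \<le> \<omega> \<beta> then word (q @ [Ghost \<alpha> k, Edge \<beta> k]) else 0)"
    by (rule sum.inter_filter) simp
  finally show ?thesis by (simp add: reduct_def)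
qed

text \<open>The last two equivalences are the reason why one reduction is enough: a replacement pair
  gets along with its neighbours exactly as the original pair does. An edge-ghost replacement keeps
  both indices and a ghost-edge replacement keeps both arcs, and these are what the adjacent pairs
  are tested for. The new pair is itself allowed because its arc is not the chosen one, or because
  its index is at least 2.\<close>

lemma replacements_properties:
  assumes "x \<in> arrow_letters" "y \<in> arrow_letters" "letter_range E x = letter_source E y"
    and "forbidden x y" "(x', y') \<in> replacements x y"
  shows "x' \<in> arrow_letters" "y' \<in> arrow_letters"
    and "letter_source E x' = letter_source E x" "letter_range E x' = letter_source E y'"
    and "letter_range E y' = letter_range E y"
    and "\<not> forbidden x' y'"
    and "forbidden z x' \<longleftrightarrow> forbidden z x" "forbidden y' z \<longleftrightarrow> forbidden y z"
proof -
  show "x' \<in> arrow_letters" "y' \<in> arrow_letters"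
    "letter_source E x' = letter_source E x" "letter_range E x' = letter_source E y'"
    "letter_range E y' = letter_range E y" "\<not> forbidden x' y'"
    using assms by (cases "(x, y)" rule: forbidden.cases; auto)+
  show "forbidden z x' \<longleftrightarrow> forbidden z x" "forbidden y' z \<longleftrightarrow> forbidden y z"
    using assms by (cases "(x, y)" rule: forbidden.cases; cases z; auto)+
qed

text \<open>A pair that cancels to a vertex must be a closed path; dropping it therefore leaves a
  word that still ends at the range of \<open>y\<close>.\<close>

lemma cancels_imp_closed: "forbidden x y \<Longrightarrow> letter_range E x = letter_source E y \<Longrightarrow> cancels x y
  \<Longrightarrow> letter_range E y = letter_source E x"
  by (cases "(x, y)" rule: forbidden.cases) auto

section \<open>Normal words\<close>

definition composable :: "('v, 'e) letter \<Rightarrow> ('v, 'e) letter \<Rightarrow> bool" where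
  "composable x y \<longleftrightarrow> letter_range E x = letter_source E y \<and> \<not> forbidden x y"

text \<open>
  Every normal word starts with a vertex, so that a path of length 0 is a normal word as well.
\<close>

definition normal :: "('v, 'e) letter list \<Rightarrow> bool" where
  "normal p
    \<longleftrightarrow> p \<noteq> [] \<and> hd p \<in> Vertex ` verts E \<and> set (tl p) \<subseteq> arrow_letters \<and> successively composable p"

lemma normal_not_Nil [simp]: "\<not> normal []"
  by (simp add: normal_def)

lemma normal_Vertex [simp]: "normal [Vertex v] \<longleftrightarrow> v \<in> verts E"
  by (auto simp: normal_def)

lemma normal_append:
  assumes "p \<noteq> []"
  shows "normal (p @ q) \<longleftrightarrow>
    normal p \<and> set q \<subseteq> arrow_letters \<and> successively composable q
      \<and> (q \<noteq> [] \<longrightarrow> composable (last p) (hd q))"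
  using assms by (auto simp: normal_def successively_append_iff)

lemma normal_snoc:
  assumes "normal p"
  shows "normal (p @ [y]) \<longleftrightarrow> y \<in> arrow_letters \<and> composable (last p) y"
proof -
  have "p \<noteq> []" using assms by auto
  then show ?thesis using assms by (simp add: normal_append)
qed

lemma normal_in_lists: "normal p \<Longrightarrow> p \<in> lists (letters E \<omega>)"
  by (cases p) (auto simp: normal_def letters_eq)

lemma normal_range_in_verts: "normal p \<Longrightarrow> letter_range E (last p) \<in> verts E"
  using normal_in_lists[of p] by (intro letter_range_in_verts) (auto simp: normal_def)

lemma normal_last_cases:
  assumes "normal p"
  obtains (Vertex) v where "v \<in> verts E" "p = [Vertex v]"
    | (snoc) q x where "p = q @ [x]" "normal q" "x \<in> arrow_letters" "composable (last q) x"
proof (cases p rule: rev_cases)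
  case Nil
  then show ?thesis using assms by simp
next
  case (snoc q x)
  show ?thesis
  proof (cases "q = []")
    case True
    then show ?thesis using assms snoc that(1) by (auto simp: normal_def)
  next
    case False
    then show ?thesis using assms that(2)[of q x] by (auto simp: normal_append snoc)
  qed
qed

lemma forbidden_last:
  assumes "normal p" "forbidden (last p) y"
  obtains q x where "p = q @ [x]" "normal q" "x \<in> arrow_letters" "composable (last q) x"
    "forbidden x y"
  using assms(1)
proof (cases rule: normal_last_cases)
  case (snoc q x)
  then show ?thesis using that assms by simp
qed (use assms in simp)

lemma normal_replacement:
  assumes "normal (q @ [x])" "x \<in> arrow_letters" "y \<in> arrow_letters"
    and "letter_range E x = letter_source E y" "forbidden x y" "(x', y') \<in> replacements x y"
  shows "normal (q @ [x', y'])"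
proof -
  note r = replacements_properties[OF assms(2-6)]
  have q: "q \<noteq> []"
  proof
    assume "q = []"
    then have "x \<in> Vertex ` verts E" using assms(1) by (simp add: normal_def)
    then show False using assms(2) by auto
  qed
  then show ?thesis using assms(1) r by (auto simp: normal_append composable_def)
qed

text \<open>The normal form of \<open>p\<close> followed by \<open>y\<close>, without recursion:
  after one reduction the result is already normal. Words that are not normal are sent to 0, so that
  the action is defined on all finitely supported functions.\<close>

definition step ::
    "('v, 'e) letter list \<Rightarrow> ('v, 'e) letter \<Rightarrow> (('v, 'e) letter list \<Rightarrow>\<^sub>0 'r::ring_1)" where
  "step p y =
    (if \<not> normal p \<or> y \<notin> letters E \<omega> \<or> letter_range E (last p) \<noteq> letter_source E y then 0
     else if y \<notin> arrow_letters then word p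
     else if forbidden (last p) y then reduct (butlast p) (last p) y
     else word (p @ [y]))"

lemma step_not_normal [simp]: "\<not> normal p \<Longrightarrow> step p y = 0"
  by (simp add: step_def)

lemma step_mismatch: "letter_range E (last p) \<noteq> letter_source E y \<Longrightarrow> step p y = 0"
  by (simp add: step_def)

lemma step_Vertex: "normal p \<Longrightarrow> v \<in> verts E
  \<Longrightarrow> step p (Vertex v) = (if letter_range E (last p) = v then word p else 0)"
  by (simp add: step_def letters_eq)

lemma step_composable: "normal p \<Longrightarrow> y \<in> arrow_letters \<Longrightarrow> composable (last p) y
  \<Longrightarrow> step p y = word (p @ [y])"
  by (simp add: step_def letters_eq composable_def)

lemma step_forbidden:
  "normal (q @ [x]) \<Longrightarrow> y \<in> arrow_letters \<Longrightarrow> letter_range E x = letter_source E y \<Longrightarrow> forbidden x y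
    \<Longrightarrow> step (q @ [x]) y = reduct q x y"
  by (simp add: step_def letters_eq)

lemma step_cases:
  assumes "normal p" "y \<in> letters E \<omega>"
  obtains (mismatch) "letter_range E (last p) \<noteq> letter_source E y"
    | (Vertex) "y = Vertex (letter_range E (last p))"
    | (composable) "y \<in> arrow_letters" "composable (last p) y"
    | (forbidden) q x where "p = q @ [x]" "normal q" "x \<in> arrow_letters" "composable (last q) x"
        "y \<in> arrow_letters" "letter_range E x = letter_source E y" "forbidden x y"
proof (cases "letter_range E (last p) = letter_source E y")
  case r: True
  consider "y \<in> Vertex ` verts E" | "y \<in> arrow_letters" using assms(2) by (auto simp: letters_eq)
  then show ?thesis
  proof cases
    case 1
    then show ?thesis using r Vertex by auto
  next
    case 2
    show ?thesis
    proof (cases "forbidden (last p) y")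
      case True
      then show ?thesis using forbidden_last[OF assms(1) True] forbidden 2 r by (metis last_snoc)
    next
      case False
      then show ?thesis using composable 2 r by (simp add: composable_def)
    qed
  qed
qed (rule mismatch)

lemma keys_reduct:
  assumes "w \<in> Poly_Mapping.keys (reduct q x y :: (('v, 'e) letter list \<Rightarrow>\<^sub>0 'r::ring_1))"
  shows "w = q \<and> cancels x y \<or> (\<exists>(x', y')\<in>replacements x y. w = q @ [x', y'])"
proof -
  let ?u = "(if cancels x y then word q else 0) :: (('v, 'e) letter list \<Rightarrow>\<^sub>0 'r::ring_1)"
  let ?v = "\<lambda>z. (case z of (x', y') \<Rightarrow> word (q @ [x', y'])) :: (('v, 'e) letter list \<Rightarrow>\<^sub>0 'r::ring_1)"
  have "w \<in> Poly_Mapping.keys ?u \<union> (\<Union>z\<in>replacements x y. Poly_Mapping.keys (?v z))"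
    using assms unfolding reduct_def by (blast dest: subsetD[OF keys_diff] subsetD[OF keys_sum])
  then show ?thesis by (fastforce split: if_splits)
qed

text \<open>Reductions happen only at the right end, so the first letter survives. A replacement
  keeps the length that appending \<open>y\<close> would give, a cancellation loses two letters, and
  a vertex letter adds nothing. The length bound is what later isolates the longest words.\<close>

lemma keys_step:
  assumes "w \<in> Poly_Mapping.keys (step p y :: (('v, 'e) letter list \<Rightarrow>\<^sub>0 'r::ring_1))"
  shows "normal w \<and> letter_range E (last w) = letter_range E y \<and> hd w = hd p
    \<and> length w \<le> length p + (if y \<in> arrow_letters then 1 else 0)"
proof -
  have p: "normal p" and y: "y \<in> letters E \<omega>"
    using assms by (auto simp: step_def split: if_splits)
  from p y show ?thesis
  proof (cases rule: step_cases)
    case mismatch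
    then show ?thesis using assms by (simp add: step_mismatch)
  next
    case Vertex
    then show ?thesis using assms p normal_range_in_verts[OF p] by (simp add: step_Vertex)
  next
    case composable
    moreover have "p \<noteq> []" using p by auto
    ultimately show ?thesis using assms p by (auto simp: step_composable normal_snoc)
  next
    case (forbidden q x)
    then have "w \<in> Poly_Mapping.keys (reduct q x y :: (('v, 'e) letter list \<Rightarrow>\<^sub>0 'r::ring_1))"
      using assms p by (simp add: step_forbidden)
    from keys_reduct[OF this] show ?thesis
    proof
      assume "w = q \<and> cancels x y"
      then show ?thesis
        using forbidden cancels_imp_closed[of x y] by (cases q) (auto simp: composable_def)
    next
      assume "\<exists>(x', y')\<in>replacements x y. w = q @ [x', y']"
      then obtain x' y' where xy: "(x', y') \<in> replacements x y" "w = q @ [x', y']" by auto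
      have "q \<noteq> []" using forbidden by auto
      then show ?thesis
        using forbidden p xy normal_replacement[of q x y x' y']
          replacements_properties[of x y x' y']
        by auto
    qed
  qed
qed

text \<open>The coefficients of \<open>step p y\<close> are integer multiples of 1 and hence
  central. This lets right scalars pass through the action.\<close>

lemma word_scale_right_step: "word_scale_right (step p y) c = word_scale c (step p y)"
proof -
  have "word_scale_right (if b then word q else 0) c = word_scale c (if b then word q else 0)"
    for q :: "('v, 'e) letter list" and b
    by (simp add: additive.zero[OF additive_word_scale_right])
  then show ?thesis
    unfolding step_def reduct_def
    by (auto simp: additive.diff[OF additive_word_scale_right]
      additive.sum[OF additive_word_scale_right]
      word_scale_diff additive.sum[OF additive_word_scale] additive.zero[OF additive_word_scale_right]
      intro!: sum.cong)
qed

section \<open>The right action of the free ring\<close>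

definition letter_action ::
    "('v, 'e) letter \<Rightarrow> (('v, 'e) letter list \<Rightarrow>\<^sub>0 'r::ring_1) \<Rightarrow> (('v, 'e) letter list \<Rightarrow>\<^sub>0 'r)" where
  "letter_action y f = (\<Sum>p\<in>Poly_Mapping.keys f. word_scale (Poly_Mapping.lookup f p) (step p y))"

fun word_action ::
    "('v, 'e) letter list \<Rightarrow> (('v, 'e) letter list \<Rightarrow>\<^sub>0 'r::ring_1) \<Rightarrow> (('v, 'e) letter list \<Rightarrow>\<^sub>0 'r)" where
  "word_action [] f = f"
| "word_action (y # w) f = word_action w (letter_action y f)"

text \<open>The coefficients of \<open>g\<close> are multiplied on from the right before its words
  are applied, as in the product of the free ring; this makes it a right action without commuting
  coefficients.\<close>

definition action ::
    "(('v, 'e) letter list \<Rightarrow>\<^sub>0 'r::ring_1) \<Rightarrow> (('v, 'e) letter list \<Rightarrow>\<^sub>0 'r) \<Rightarrow> (('v, 'e) letter list \<Rightarrow>\<^sub>0 'r)" where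
  "action f g
    = (\<Sum>w\<in>Poly_Mapping.keys g. word_action w (word_scale_right f (Poly_Mapping.lookup g w)))"

lemma additive_letter_action: "additive (letter_action y)"
  unfolding letter_action_def by (rule additive_sum_keys) (rule additive_word_scale_left)

lemma additive_word_action: "additive (word_action w)"
  by (induction w) (auto intro: additive.intro additive_compose[OF _ additive_letter_action])

lemma additive_action_left: "additive (\<lambda>f. action f g)"
  unfolding action_def
  by (intro additive_fun_sum additive_compose[OF additive_word_action] additive_word_scale_right)

lemma additive_action: "additive (action f)"
  unfolding action_def
  by (intro additive_sum_keys additive_compose[OF additive_word_action]
    additive_word_scale_right_scalar)

lemma letter_action_single [simp]:
  "letter_action y (Poly_Mapping.single p c) = word_scale c (step p y)"
  by (simp add: letter_action_def)

lemma action_single [simp]: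
  "action f (Poly_Mapping.single w c) = word_action w (word_scale_right f c)"
  by (simp add: action_def additive.zero[OF additive_word_action]
    additive.zero[OF additive_word_scale_right_scalar])

lemma word_action_append: "word_action (u @ v) f = word_action v (word_action u f)"
  by (induction u arbitrary: f) auto

lemma letter_action_scale: "letter_action y (word_scale c f) = word_scale c (letter_action y f)"
  by (rule additive_eq_on_singles[where f = f and F = "\<lambda>f. letter_action y (word_scale c f)"
        and G = "\<lambda>f. word_scale c (letter_action y f)"])
    (auto intro: additive_compose additive_letter_action additive_word_scale
      simp: word_scale_word_scale)

lemma letter_action_scale_right:
  "letter_action y (word_scale_right f c) = word_scale_right (letter_action y f) c"
  by (rule additive_eq_on_singles[where f = f and F = "\<lambda>f. letter_action y (word_scale_right f c)"
        and G = "\<lambda>f. word_scale_right (letter_action y f) c"])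
    (auto intro: additive_compose[OF additive_letter_action additive_word_scale_right]
      additive_compose[OF additive_word_scale_right additive_letter_action]
      simp: word_scale_word_scale word_scale_right_word_scale word_scale_right_step)

lemma word_action_scale: "word_action w (word_scale c f) = word_scale c (word_action w f)"
  by (induction w arbitrary: f) (auto simp: letter_action_scale)

lemma word_action_scale_right:
  "word_action w (word_scale_right f c) = word_scale_right (word_action w f) c"
  by (induction w arbitrary: f) (auto simp: letter_action_scale_right)

lemma action_scale: "action (word_scale c f) g = word_scale c (action f g)"
  by (simp add: action_def word_scale_right_word_scale word_action_scale
    additive.sum[OF additive_word_scale])

text \<open>This holds before any relation is used: a concatenated word is applied letter by letter,
  and right scalars pass through \<open>word_action\<close>.\<close>

lemma action_word_mult: "action f (g \<star> h) = action (action f g) h"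
proof (rule additive_eq_on_singles[where f = g and F = "\<lambda>g. action f (g \<star> h)"
  and G = "\<lambda>g. action (action f g) h"])
  show "additive (\<lambda>g. action f (g \<star> h))"
    by (rule additive_compose[OF additive_action additive_word_mult_left])
  show "additive (\<lambda>g. action (action f g) h)"
    by (rule additive_compose[OF additive_action_left additive_action])
  fix u :: "('v, 'e) letter list" and c :: 'a
  let ?s = "Poly_Mapping.single u c"
  show "action f (?s \<star> h) = action (action f ?s) h"
    by (rule additive_eq_on_singles[where f = h and F = "\<lambda>h. action f (?s \<star> h)"
      and G = "\<lambda>h. action (action f ?s) h"])
      (auto intro: additive_compose[OF additive_action additive_word_mult_right] additive_action
        simp: word_action_append word_action_scale_right word_scale_right_word_scale_right)
qed

end

section \<open>The relations act as zero\<close>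

context LV_graph
begin

text \<open>Relation (3) without overlap. Every arc other than the chosen one contributes the normal
  word \<open>p \<alpha>\<^sub>i \<alpha>\<^sub>j\<^sup>*\<close>, and reducing the term of the
  chosen arc gives the desired right-hand side minus exactly these words.\<close>

lemma edge_ghost_sum_composable:
  fixes p :: "('v, 'e) letter list"
  assumes p: "normal p" and v: "letter_range E (last p) = v" "\<not> is_sink E v"
    and ij: "i \<in> {1..vertex_weight E \<omega> v}" "j \<in> {1..vertex_weight E \<omega> v}"
    and nf: "\<And>\<alpha>. \<not> forbidden (last p) (Edge \<alpha> i)"
  shows "(\<Sum>\<alpha>\<in>out_arcs E v. if i \<le> \<omega> \<alpha> \<and> j \<le> \<omega> \<alpha>
      then letter_action (Ghost \<alpha> j) (step p (Edge \<alpha> i)) else 0) =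
    (if i = j then word p else 0 :: (('v, 'e) letter list \<Rightarrow>\<^sub>0 'r::ring_1))"
    (is "(\<Sum>\<alpha>\<in>?S. ?T \<alpha>) = _")
proof -
  have vv: "v \<in> verts E" using normal_range_in_verts[OF p] v by simp
  note s = special[OF vv v(2)]
  let ?s = "special v"
  let ?W = "\<lambda>\<alpha>. if i \<le> \<omega> \<alpha> \<and> j \<le> \<omega> \<alpha> then word (p @ [Edge \<alpha> i, Ghost \<alpha> j]) else 0
    :: (('v, 'e) letter list \<Rightarrow>\<^sub>0 'r)"
  have step1: "letter_action (Ghost \<alpha> j) (step p (Edge \<alpha> i)) = step (p @ [Edge \<alpha> i]) (Ghost \<alpha> j)"
    and norm1: "normal (p @ [Edge \<alpha> i])"
    if "\<alpha> \<in> ?S" "i \<le> \<omega> \<alpha>" for \<alpha>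
  proof -
    have "Edge \<alpha> i \<in> arrow_letters" "composable (last p) (Edge \<alpha> i)"
      using that ij v nf by (auto simp: composable_def)
    then show "letter_action (Ghost \<alpha> j) (step p (Edge \<alpha> i)) = step (p @ [Edge \<alpha> i]) (Ghost \<alpha> j)"
      "normal (p @ [Edge \<alpha> i])"
      using p by (simp_all add: step_composable normal_snoc)
  qed
  have other: "?T \<alpha> = ?W \<alpha>" if "\<alpha> \<in> ?S - {?s}" for \<alpha>
    using that ij step1[of \<alpha>] norm1[of \<alpha>]
    by (auto simp: step_composable composable_def)
  have "?T ?s = reduct p (Edge ?s i) (Ghost ?s j)"
    using s ij step1[of ?s] norm1[of ?s] by (simp add: step_forbidden)
  also have "\<dots> = (if i = j then word p else 0) - (\<Sum>\<gamma>\<in>?S - {?s}. ?W \<gamma>)"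
    using s by (simp add: reduct_Edge_Ghost)
  finally have "?T ?s = \<dots>" .
  moreover have "(\<Sum>\<alpha>\<in>?S. ?T \<alpha>) = ?T ?s + (\<Sum>\<alpha>\<in>?S - {?s}. ?T \<alpha>)"
    by (rule sum.remove) (use s row_finite[OF vv] in auto)
  moreover have "(\<Sum>\<alpha>\<in>?S - {?s}. ?T \<alpha>) = (\<Sum>\<alpha>\<in>?S - {?s}. ?W \<alpha>)"
    by (intro sum.cong refl other)
  ultimately show ?thesis by simp
qed

text \<open>The remaining case is the overlap \<open>q \<gamma>\<^sub>1\<^sup>* \<alpha>\<^sub>1
  \<alpha>\<^sub>j\<^sup>*\<close>, where already the first letter forces a reduction. It turns the
  sum into one term for \<alpha> = \<gamma> minus sums over k of at least 2, and for fixed k the sum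
  over the arcs is relation (3) applied to \<open>q \<gamma>\<^sub>k\<^sup>*\<close>, where no
  reduction occurs at the first letter.\<close>

lemma edge_ghost_sum:
  fixes p :: "('v, 'e) letter list"
  assumes p: "normal p" and v: "letter_range E (last p) = v" "\<not> is_sink E v"
    and ij: "i \<in> {1..vertex_weight E \<omega> v}" "j \<in> {1..vertex_weight E \<omega> v}"
  shows "(\<Sum>\<alpha>\<in>out_arcs E v. if i \<le> \<omega> \<alpha> \<and> j \<le> \<omega> \<alpha>
      then letter_action (Ghost \<alpha> j) (step p (Edge \<alpha> i)) else 0) =
    (if i = j then word p else 0 :: (('v, 'e) letter list \<Rightarrow>\<^sub>0 'r::ring_1))"
    (is "(\<Sum>\<alpha>\<in>?S. ?T \<alpha>) = _")
proof (cases "\<forall>\<alpha>. \<not> forbidden (last p) (Edge \<alpha> i)")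
  case True
  then show ?thesis using edge_ghost_sum_composable[OF assms] by blast
next
  case False
  then obtain \<gamma> where i: "i = 1" and l: "last p = Ghost \<gamma> 1"
    by (auto simp: forbidden_Edge_iff)
  obtain q where q: "p = q @ [Ghost \<gamma> 1]" "normal q" "Ghost \<gamma> 1 \<in> arrow_letters"
    "composable (last q) (Ghost \<gamma> 1)"
    using p by (cases rule: normal_last_cases) (use l in auto)
  have g: "\<gamma> \<in> arcs E" "tail E \<gamma> = v" and g1: "\<gamma> \<in> ?S"
    using q v l by auto
  have fin: "finite ?S" using row_finite normal_range_in_verts[OF p] v by simp
  \<comment> \<open>Whether a letter may precede a ghost depends only on the arc, so index 1 can be
    changed to any k.\<close>
  have comp: "composable (last q) (Ghost \<gamma> k)" for k
    using q(4) by (simp add: composable_def forbidden_Ghost_iff)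
  have norm: "normal (q @ [Ghost \<gamma> k])" if "1 \<le> k" "k \<le> \<omega> \<gamma>" for k
    using that q g comp by (simp add: normal_snoc)
  let ?q = "if j \<le> \<omega> \<gamma> then word (q @ [Ghost \<gamma> j]) else 0 :: (('v, 'e) letter list \<Rightarrow>\<^sub>0 'r)"
  let ?U = "\<lambda>k \<alpha>. if k \<le> \<omega> \<alpha> \<and> j \<le> \<omega> \<alpha>
    then letter_action (Ghost \<alpha> j) (step (q @ [Ghost \<gamma> k]) (Edge \<alpha> k)) else 0
    :: (('v, 'e) letter list \<Rightarrow>\<^sub>0 'r)"
  have expand: "?T \<alpha> = (if \<gamma> = \<alpha> then ?q else 0) - (\<Sum>k=2..\<omega> \<gamma>. ?U k \<alpha>)" if \<alpha>: "\<alpha> \<in> ?S" for \<alpha>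
  proof (cases "j \<le> \<omega> \<alpha>")
    case True
    have w: "1 \<le> \<omega> \<alpha>" using \<alpha> weight_pos by simp
    have "step p (Edge \<alpha> i) = (reduct q (Ghost \<gamma> 1) (Edge \<alpha> 1) :: (('v, 'e) letter list \<Rightarrow>\<^sub>0 'r))"
      unfolding q(1) i using p q \<alpha> g w by (intro step_forbidden) auto
    then have "?T \<alpha> = letter_action (Ghost \<alpha> j) (reduct q (Ghost \<gamma> 1) (Edge \<alpha> 1))"
      using True w i by simp
    also have "\<dots> = (if \<gamma> = \<alpha> then step q (Ghost \<alpha> j) else 0)
      - (\<Sum>k=2..\<omega> \<gamma>. if k \<le> \<omega> \<alpha> then step (q @ [Ghost \<gamma> k, Edge \<alpha> k]) (Ghost \<alpha> j) else 0)"
      by (simp add: reduct_Ghost_Edge additive.diff[OF additive_letter_action]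
        additive.sum[OF additive_letter_action] if_distrib[of "letter_action _"]
        additive.zero[OF additive_letter_action] cong: if_cong)
    also have "(if \<gamma> = \<alpha> then step q (Ghost \<alpha> j) else 0) = (if \<gamma> = \<alpha> then ?q else 0)"
      using True ij g q comp by (auto simp: step_composable)
    also have "(\<Sum>k=2..\<omega> \<gamma>. if k \<le> \<omega> \<alpha> then step (q @ [Ghost \<gamma> k, Edge \<alpha> k]) (Ghost \<alpha> j) else 0)
      = (\<Sum>k=2..\<omega> \<gamma>. ?U k \<alpha>)"
    proof (intro sum.cong refl)
      fix k assume k: "k \<in> {2..\<omega> \<gamma>}"
      show "(if k \<le> \<omega> \<alpha> then step (q @ [Ghost \<gamma> k, Edge \<alpha> k]) (Ghost \<alpha> j) else 0) = ?U k \<alpha>"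
        using True k \<alpha> g norm[of k] by (auto simp: step_composable composable_def)
    qed
    finally show ?thesis .
  qed auto
  have "(\<Sum>\<alpha>\<in>?S. ?T \<alpha>) = (\<Sum>\<alpha>\<in>?S. (if \<gamma> = \<alpha> then ?q else 0) - (\<Sum>k=2..\<omega> \<gamma>. ?U k \<alpha>))"
    by (intro sum.cong refl expand)
  \<comment> \<open>Exchanging the sums makes the sum over arcs the inner one, to which the case
    without overlap applies for each k.\<close>
  also have "\<dots> = ?q - (\<Sum>k=2..\<omega> \<gamma>. \<Sum>\<alpha>\<in>?S. ?U k \<alpha>)"
    using fin g1 unfolding sum_subtractf
      by (subst sum.swap) (simp add: sum.delta del: in_out_arcs_conv)
  also have "(\<Sum>k=2..\<omega> \<gamma>. \<Sum>\<alpha>\<in>?S. ?U k \<alpha>) = (\<Sum>k=2..\<omega> \<gamma>. if k = j then word (q @ [Ghost \<gamma> k]) else 0)"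
  proof (intro sum.cong refl)
    fix k assume k: "k \<in> {2..\<omega> \<gamma>}"
    then have "k \<in> {1..vertex_weight E \<omega> v}"
      using weight_le_vertex_weight[OF g(1)] g by auto
    then show "(\<Sum>\<alpha>\<in>?S. ?U k \<alpha>) = (if k = j then word (q @ [Ghost \<gamma> k]) else 0)"
      using k v g ij norm[of k] by (intro edge_ghost_sum_composable) auto
  qed
  also have "\<dots> = (if 2 \<le> j \<and> j \<le> \<omega> \<gamma> then word (q @ [Ghost \<gamma> j]) else 0)"
    by (simp add: sum.delta)
  \<comment> \<open>For j at least 2 the two terms cancel; for j = 1 only the first is present, and
    it is \<open>p\<close>.\<close>
  also have "?q - \<dots> = (if i = j then word p else 0)"
    using ij i q by auto
  finally show ?thesis .
qed

text \<open>Relation (4) without overlap: the term of index 1 is forbidden and reduces to the vertex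
  term minus all terms of index at least 2. If the two arcs start at different vertices, they are
  distinct and every term vanishes by mismatch.\<close>

lemma ghost_edge_sum_composable:
  fixes p :: "('v, 'e) letter list"
  assumes p: "normal p" and arcs: "\<alpha> \<in> arcs E" "\<beta> \<in> arcs E"
    and r: "letter_range E (last p) = head E \<alpha>"
    and nf: "\<And>i. \<not> forbidden (last p) (Ghost \<alpha> i)"
  shows "(\<Sum>i=1..\<omega> \<alpha>. if i \<le> \<omega> \<beta> then letter_action (Edge \<beta> i) (step p (Ghost \<alpha> i)) else 0) =
    (if \<alpha> = \<beta> then word p else 0 :: (('v, 'e) letter list \<Rightarrow>\<^sub>0 'r::ring_1))"
    (is "(\<Sum>i=1..\<omega> \<alpha>. ?T i) = _")
proof -
  have step1: "letter_action (Edge \<beta> i) (step p (Ghost \<alpha> i)) = step (p @ [Ghost \<alpha> i]) (Edge \<beta> i)"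
    and norm1: "normal (p @ [Ghost \<alpha> i])"
    if "1 \<le> i" "i \<le> \<omega> \<alpha>" for i
  proof -
    have "Ghost \<alpha> i \<in> arrow_letters" "composable (last p) (Ghost \<alpha> i)"
      using that r nf arcs by (auto simp: composable_def)
    then show "letter_action (Edge \<beta> i) (step p (Ghost \<alpha> i)) = step (p @ [Ghost \<alpha> i]) (Edge \<beta> i)"
      "normal (p @ [Ghost \<alpha> i])"
      using p by (simp_all add: step_composable normal_snoc)
  qed
  show ?thesis
  proof (cases "tail E \<alpha> = tail E \<beta>")
    case False
    then have "?T i = 0" if "i \<in> {1..\<omega> \<alpha>}" for i
      using that step1[of i] by (auto simp: step_mismatch)
    then have "(\<Sum>i=1..\<omega> \<alpha>. ?T i) = 0" by (rule sum.neutral[rule_format])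
    then show ?thesis using False by auto
  next
    case True
    let ?W = "\<lambda>i. if i \<le> \<omega> \<beta> then word (p @ [Ghost \<alpha> i, Edge \<beta> i]) else 0
      :: (('v, 'e) letter list \<Rightarrow>\<^sub>0 'r)"
    have w: "1 \<le> \<omega> \<alpha>" "1 \<le> \<omega> \<beta>" using arcs weight_pos by auto
    have other: "?T i = ?W i" if "i \<in> {2..\<omega> \<alpha>}" for i
      using that True step1[of i] norm1[of i] arcs
      by (auto simp: step_composable composable_def)
    have "?T 1 = reduct p (Ghost \<alpha> 1) (Edge \<beta> 1)"
      using True w step1[of 1] norm1[of 1] arcs by (simp add: step_forbidden)
    also have "\<dots> = (if \<alpha> = \<beta> then word p else 0) - (\<Sum>i=2..\<omega> \<alpha>. ?W i)"
      by (rule reduct_Ghost_Edge)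
    finally have "?T 1 = \<dots>" .
    moreover have "{1..\<omega> \<alpha>} = insert 1 {2..\<omega> \<alpha>}" using w by auto
    then have "(\<Sum>i=1..\<omega> \<alpha>. ?T i) = ?T 1 + (\<Sum>i=2..\<omega> \<alpha>. ?T i)"
      by simp
    moreover have "(\<Sum>i=2..\<omega> \<alpha>. ?T i) = (\<Sum>i=2..\<omega> \<alpha>. ?W i)"
      by (intro sum.cong refl other)
    ultimately show ?thesis by simp
  qed
qed

text \<open>The remaining case has p ending in \<open>\<alpha>\<^sub>k\<close> with \<alpha> the
  chosen arc, so that every ghost \<open>\<alpha>\<^sub>i\<^sup>*\<close> forces a reduction. This
  replaces \<alpha> by the other arcs \<gamma> with the same source, and for each \<gamma> the sum
  over i is relation (4) applied to \<open>q \<gamma>\<^sub>k\<close>, without overlap.\<close>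

lemma ghost_edge_sum:
  fixes p :: "('v, 'e) letter list"
  assumes p: "normal p" and arcs: "\<alpha> \<in> arcs E" "\<beta> \<in> arcs E"
    and r: "letter_range E (last p) = head E \<alpha>"
  shows "(\<Sum>i=1..\<omega> \<alpha>. if i \<le> \<omega> \<beta> then letter_action (Edge \<beta> i) (step p (Ghost \<alpha> i)) else 0) =
    (if \<alpha> = \<beta> then word p else 0 :: (('v, 'e) letter list \<Rightarrow>\<^sub>0 'r::ring_1))"
    (is "(\<Sum>i=1..\<omega> \<alpha>. ?T i) = _")
proof (cases "\<forall>i. \<not> forbidden (last p) (Ghost \<alpha> i)")
  case True
  then show ?thesis using ghost_edge_sum_composable[OF assms] by blast
next
  case False
  then obtain k where sp: "special (tail E \<alpha>) = \<alpha>" and l: "last p = Edge \<alpha> k"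
    by (auto simp: forbidden_Ghost_iff elim: forbidden.elims)
  obtain q where q: "p = q @ [Edge \<alpha> k]" "normal q" "Edge \<alpha> k \<in> arrow_letters"
    "composable (last q) (Edge \<alpha> k)"
    using p by (cases rule: normal_last_cases) (use l in auto)
  have k: "1 \<le> k" "k \<le> \<omega> \<alpha>" using q by auto
  let ?S = "out_arcs E (tail E \<alpha>) - {\<alpha>}"
  have fin: "finite ?S" using row_finite arcs by simp
  have comp: "composable (last q) (Edge \<gamma> k)" if "tail E \<gamma> = tail E \<alpha>" for \<gamma>
    using q(4) that by (simp add: composable_def forbidden_Edge_iff)
  have norm: "normal (q @ [Edge \<gamma> k])" if "\<gamma> \<in> arcs E" "tail E \<gamma> = tail E \<alpha>" "k \<le> \<omega> \<gamma>" for \<gamma>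
    using that q k comp by (simp add: normal_snoc)
  \<comment> \<open>The chosen arc has maximal weight, so a sum up to \<omega> \<alpha> reaches all
    indices of \<gamma> and relation (4) for \<gamma> appears in full.\<close>
  have le: "\<omega> \<gamma> \<le> \<omega> \<alpha>" if "\<gamma> \<in> ?S" for \<gamma>
    using that weight_le_vertex_weight[of \<gamma>] special(3)[of "tail E \<alpha>"] sp arcs not_sink_tail[of \<alpha>]
    by auto
  let ?U = "\<lambda>\<gamma> i. if i \<le> \<omega> \<beta> \<and> i \<le> \<omega> \<gamma>
    then letter_action (Edge \<beta> i) (step (q @ [Edge \<gamma> k]) (Ghost \<gamma> i)) else 0
    :: (('v, 'e) letter list \<Rightarrow>\<^sub>0 'r)"
  have expand: "?T i = (if k = i then if i \<le> \<omega> \<beta> then step q (Edge \<beta> i) else 0 else 0)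
      - (\<Sum>\<gamma>\<in>?S. if k \<le> \<omega> \<gamma> then ?U \<gamma> i else 0)" if i: "i \<in> {1..\<omega> \<alpha>}" for i
  proof (cases "i \<le> \<omega> \<beta>")
    case True
    have "step p (Ghost \<alpha> i) = (reduct q (Edge \<alpha> k) (Ghost \<alpha> i) :: (('v, 'e) letter list \<Rightarrow>\<^sub>0 'r))"
      unfolding q(1) using p q i arcs sp by (intro step_forbidden) auto
    then have "?T i = letter_action (Edge \<beta> i) (reduct q (Edge \<alpha> k) (Ghost \<alpha> i))"
      using True by simp
    also have "\<dots> = (if k = i then step q (Edge \<beta> i) else 0)
      - (\<Sum>\<gamma>\<in>?S. if k \<le> \<omega> \<gamma> \<and> i \<le> \<omega> \<gamma> then step (q @ [Edge \<gamma> k, Ghost \<gamma> i]) (Edge \<beta> i) else 0)"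
      using arcs by (simp add: reduct_Edge_Ghost additive.diff[OF additive_letter_action]
        additive.sum[OF additive_letter_action] if_distrib[of "letter_action _"]
        additive.zero[OF additive_letter_action] cong: if_cong)
    also have "(\<Sum>\<gamma>\<in>?S. if k \<le> \<omega> \<gamma> \<and> i \<le> \<omega> \<gamma> then step (q @ [Edge \<gamma> k, Ghost \<gamma> i]) (Edge \<beta> i) else 0)
      = (\<Sum>\<gamma>\<in>?S. if k \<le> \<omega> \<gamma> then ?U \<gamma> i else 0)"
    proof (intro sum.cong refl)
      fix \<gamma> assume "\<gamma> \<in> ?S"
      then show "(if k \<le> \<omega> \<gamma> \<and> i \<le> \<omega> \<gamma> then step (q @ [Edge \<gamma> k, Ghost \<gamma> i]) (Edge \<beta> i) else 0)
        = (if k \<le> \<omega> \<gamma> then ?U \<gamma> i else 0)"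
        using True i norm[of \<gamma>] sp by (auto simp: step_composable composable_def)
    qed
    finally show ?thesis using True by simp
  qed (auto intro!: sum.neutral split: if_splits)
  have "(\<Sum>i=1..\<omega> \<alpha>. ?T i)
    = (\<Sum>i=1..\<omega> \<alpha>. (if k = i then if i \<le> \<omega> \<beta> then step q (Edge \<beta> i) else 0 else 0)
      - (\<Sum>\<gamma>\<in>?S. if k \<le> \<omega> \<gamma> then ?U \<gamma> i else 0))"
    by (intro sum.cong refl expand)
  also have "\<dots> = (if k \<le> \<omega> \<beta> then step q (Edge \<beta> k) else 0)
      - (\<Sum>\<gamma>\<in>?S. \<Sum>i=1..\<omega> \<alpha>. if k \<le> \<omega> \<gamma> then ?U \<gamma> i else 0)"
    using k unfolding sum_subtractf by (subst sum.swap) (simp add: sum.delta)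
  also have "(\<Sum>\<gamma>\<in>?S. \<Sum>i=1..\<omega> \<alpha>. if k \<le> \<omega> \<gamma> then ?U \<gamma> i else 0) =
    (\<Sum>\<gamma>\<in>?S. if \<gamma> = \<beta> then if k \<le> \<omega> \<beta> then word (q @ [Edge \<beta> k]) else 0 else 0)"
  proof (intro sum.cong refl)
    fix \<gamma> assume g: "\<gamma> \<in> ?S"
    show "(\<Sum>i=1..\<omega> \<alpha>. if k \<le> \<omega> \<gamma> then ?U \<gamma> i else 0) =
      (if \<gamma> = \<beta> then if k \<le> \<omega> \<beta> then word (q @ [Edge \<beta> k]) else 0 else 0)"
    proof (cases "k \<le> \<omega> \<gamma>")
      case True
      have "(\<Sum>i=1..\<omega> \<alpha>. ?U \<gamma> i) = (\<Sum>i=1..\<omega> \<gamma>. ?U \<gamma> i)"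
        using le[OF g] by (intro sum.mono_neutral_right) auto
      also have
        "\<dots> = (\<Sum>i=1..\<omega> \<gamma>. if i \<le> \<omega> \<beta> then letter_action (Edge \<beta> i) (step (q @ [Edge \<gamma> k]) (Ghost \<gamma> i)) else 0)"
        by (intro sum.cong) auto
      also have "\<dots> = (if \<gamma> = \<beta> then word (q @ [Edge \<gamma> k]) else 0)"
        using g True arcs norm[of \<gamma>] sp
        by (intro ghost_edge_sum_composable) (auto simp: forbidden_Ghost_iff)
      finally show ?thesis using True by auto
    qed auto
  qed
  also have "\<dots> = (if \<beta> \<in> ?S \<and> k \<le> \<omega> \<beta> then word (q @ [Edge \<beta> k]) else 0)"
    using fin by (simp add: sum.delta' del: in_out_arcs_conv Diff_iff)
  \<comment> \<open>If \<beta> is another arc with the same source, both terms are the same; if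
    \<beta> = \<alpha>, only the first remains and equals \<open>p\<close>; if the sources differ,
    both vanish.\<close>
  also have "(if k \<le> \<omega> \<beta> then step q (Edge \<beta> k) else 0) - \<dots> = (if \<alpha> = \<beta> then word p else 0)"
  proof (cases "tail E \<beta> = tail E \<alpha>")
    case True
    then show ?thesis
      using arcs k q comp[of \<beta>] by (auto simp: step_composable)
  next
    case False
    then show ?thesis
      using q by (auto simp: step_mismatch composable_def)
  qed
  finally show ?thesis .
qed

section \<open>From the sums over arcs and indices to the ideal of relations\<close>

lemma action_not_normal:
  fixes g :: "('v, 'e) letter list \<Rightarrow>\<^sub>0 'r::ring_1"
  assumes "\<not> normal p" "g \<in> free_carrier X"
  shows "action (word p) g = 0"
proof -
  \<comment> \<open>The carrier excludes the empty word, which would act as the identity. Any other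
    word has a first letter, and that letter sends \<open>p\<close> to 0.\<close>
  have "word_action w (Poly_Mapping.single p c) = 0" if "w \<in> Poly_Mapping.keys g" for w and c :: 'r
  proof (cases w)
    case Nil
    then show ?thesis using that assms(2) by (auto simp: free_carrier_iff)
  next
    case (Cons y u)
    then show ?thesis using assms(1) by (simp add: additive.zero[OF additive_word_action])
  qed
  then show ?thesis by (simp add: action_def)
qed

lemma action_eq_zeroI:
  assumes "g \<in> free_carrier X" "\<And>p. normal p \<Longrightarrow> action (word p) g = 0"
  shows "action f g = 0"
proof (rule additive_eq_on_singles[where F = "\<lambda>f. action f g"
  and G = "\<lambda>_. 0", OF additive_action_left])
  fix p c
  have "action (word p) g = 0"
    using assms action_not_normal by blast
  then have "action (word_scale c (word p)) g = 0"
    by (simp only: action_scale) simp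
  then show "action (Poly_Mapping.single p c) g = 0"
    by simp
qed (simp add: additive_def)

lemma edge_elem_mult_ghost_elem:
  "edge_elem \<omega> \<alpha> i \<star> ghost_elem \<omega> \<beta> j =
    (if i \<le> \<omega> \<alpha> \<and> j \<le> \<omega> \<beta> then word [Edge \<alpha> i, Ghost \<beta> j] else 0)"
  by (simp add: edge_elem_def ghost_elem_def)

lemma ghost_elem_mult_edge_elem:
  "ghost_elem \<omega> \<alpha> i \<star> edge_elem \<omega> \<beta> j =
    (if i \<le> \<omega> \<alpha> \<and> j \<le> \<omega> \<beta> then word [Ghost \<alpha> i, Edge \<beta> j] else 0)"
  by (simp add: edge_elem_def ghost_elem_def)

lemma vertex_elem_in_carrier: "v \<in> verts E \<Longrightarrow> vertex_elem v \<in> free_carrier (letters E \<omega>)"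
  by (simp add: vertex_elem_def free_carrier_single letters_eq)

lemma edge_elem_in_carrier: "\<alpha> \<in> arcs E \<Longrightarrow> 1 \<le> i \<Longrightarrow> edge_elem \<omega> \<alpha> i \<in> free_carrier (letters E \<omega>)"
  by (auto simp: edge_elem_def letters_eq intro!: free_carrier_single free_carrier_zero)

lemma ghost_elem_in_carrier: "\<alpha> \<in> arcs E \<Longrightarrow> 1 \<le> i \<Longrightarrow> ghost_elem \<omega> \<alpha> i \<in> free_carrier (letters E \<omega>)"
  by (auto simp: ghost_elem_def letters_eq intro!: free_carrier_single free_carrier_zero)

lemma leavitt_relations_in_carrier: "leavitt_relations E \<omega> \<subseteq> free_carrier (letters E \<omega>)"
proof
  fix \<rho> :: "('v, 'e) letter list \<Rightarrow>\<^sub>0 'r::ring_1"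
  assume "\<rho> \<in> leavitt_relations E \<omega>"
  then show "\<rho> \<in> free_carrier (letters E \<omega>)"
    by cases (auto intro!: free_carrier_diff free_carrier_mult free_carrier_zero free_carrier_sum
        vertex_elem_in_carrier edge_elem_in_carrier ghost_elem_in_carrier)
qed

lemmas action_diff = additive.diff[OF additive_action]
lemmas action_sum = additive.sum[OF additive_action]
lemmas action_zero = additive.zero[OF additive_action]

lemma action_leavitt_relations:
  fixes \<rho> :: "('v, 'e) letter list \<Rightarrow>\<^sub>0 'r::ring_1"
  assumes "\<rho> \<in> leavitt_relations E \<omega>"
  shows "action f \<rho> = 0"
proof (rule action_eq_zeroI)
  show "\<rho> \<in> free_carrier (letters E \<omega>)"
    using assms leavitt_relations_in_carrier by blast
  fix p :: "('v, 'e) letter list"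
  assume p: "normal p"
  have unit: "letter_action y (step p (Vertex v)) = (step p y :: (('v, 'e) letter list \<Rightarrow>\<^sub>0 'r))"
    if "v \<in> verts E" "letter_source E y = v" for v y
    using that p by (auto simp: step_Vertex step_mismatch additive.zero[OF additive_letter_action])
  have unit': "letter_action (Vertex v) (step p y) = (step p y :: (('v, 'e) letter list \<Rightarrow>\<^sub>0 'r))"
    if v: "v \<in> verts E" and y: "y \<in> letters E \<omega>" and r: "letter_range E y = v" for v y
  proof -
    \<comment> \<open>All words in \<open>step p y\<close> end at the range of \<open>y\<close>, so
      the vertex there fixes each of them.\<close>
    have "letter_action (Vertex v) (Poly_Mapping.single w c)
      = (Poly_Mapping.single w c :: (('v, 'e) letter list \<Rightarrow>\<^sub>0 'r))"
      if "w \<in> Poly_Mapping.keys (step p y :: (('v, 'e) letter list \<Rightarrow>\<^sub>0 'r))" for w c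
      using keys_step[OF that] v r by (simp add: step_Vertex)
    then show ?thesis
      by (rule additive_eq_on_singles[where f = "step p y" and F = "letter_action (Vertex v)"
        and G = "\<lambda>f. f",
            OF additive_letter_action, rotated])
        (simp_all add: additive_def)
  qed
  from assms show "action (word p) \<rho> = 0"
  proof cases
    case (vertices v w)
    then show ?thesis
      using p by (auto simp: vertex_elem_def action_diff action_zero step_Vertex
          additive.zero[OF additive_letter_action])
  next
    case (edge_source \<alpha> i)
    then show ?thesis by (simp add: vertex_elem_def edge_elem_def action_diff unit)
  next
    case (edge_range \<alpha> i)
    then show ?thesis by (simp add: vertex_elem_def edge_elem_def action_diff unit' letters_eq)
  next
    case (ghost_source \<alpha> i)
    then show ?thesis by (simp add: vertex_elem_def ghost_elem_def action_diff unit)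
  next
    case (ghost_range \<alpha> i)
    then show ?thesis by (simp add: vertex_elem_def ghost_elem_def action_diff unit' letters_eq)
  next
    case (edge_ghost v i j)
    have "action (word p) \<rho> = (\<Sum>\<alpha>\<in>out_arcs E v. if i \<le> \<omega> \<alpha> \<and> j \<le> \<omega> \<alpha>
        then letter_action (Ghost \<alpha> j) (step p (Edge \<alpha> i)) else 0) - (if i = j then step p (Vertex
          v) else 0)"
      unfolding edge_ghost(1)
      by (simp add: action_diff action_sum edge_elem_mult_ghost_elem vertex_elem_def
          if_distrib[of "action _"] action_zero cong: if_cong)
    also have "\<dots> = 0"
    proof (cases "letter_range E (last p) = v")
      case True
      then show ?thesis using edge_ghost p edge_ghost_sum[OF p True, of i j, where 'r = 'r] by (simp add: step_Vertex)
    next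
      case False
      then have "(\<Sum>\<alpha>\<in>out_arcs E v. if i \<le> \<omega> \<alpha> \<and> j \<le> \<omega> \<alpha>
        then letter_action (Ghost \<alpha> j) (step p (Edge \<alpha> i)) else 0 :: ('v, 'e) letter
          list \<Rightarrow>\<^sub>0 'r) = 0"
        by (intro sum.neutral) (auto simp: step_mismatch additive.zero[OF additive_letter_action])
      then show ?thesis using False by (auto simp: step_mismatch)
    qed
    finally show ?thesis .
  next
    case (ghost_edge \<alpha> \<beta>)
    have "action (word p) \<rho> = (\<Sum>i=1..max (\<omega> \<alpha>) (\<omega> \<beta>). if i \<le> \<omega> \<alpha> \<and> i \<le> \<omega> \<beta>
        then letter_action (Edge \<beta> i) (step p (Ghost \<alpha> i)) else 0) - (if \<alpha> = \<beta> then step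
          p (Vertex (head E \<alpha>)) else 0)"
      unfolding ghost_edge(1)
      by (simp add: action_diff action_sum ghost_elem_mult_edge_elem vertex_elem_def
          if_distrib[of "action _"] action_zero cong: if_cong)
    \<comment> \<open>Ghosts of index above \<omega> \<alpha> are 0 by convention, so the upper
      limit can be lowered to \<omega> \<alpha>.\<close>
    also have "(\<Sum>i=1..max (\<omega> \<alpha>) (\<omega> \<beta>). if i \<le> \<omega> \<alpha> \<and> i \<le> \<omega> \<beta>
        then letter_action (Edge \<beta> i) (step p (Ghost \<alpha> i)) else 0) =
      (\<Sum>i=1..\<omega> \<alpha>.
        if i \<le> \<omega> \<beta> then letter_action (Edge \<beta> i) (step p (Ghost \<alpha> i)) else 0 :: ('v, 'e) letter
          list \<Rightarrow>\<^sub>0 'r)"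
      by (rule sum.mono_neutral_cong_right) auto
    also have "\<dots> - (if \<alpha> = \<beta> then step p (Vertex (head E \<alpha>)) else 0) = 0"
    proof (cases "letter_range E (last p) = head E \<alpha>")
      case True
      then show ?thesis using ghost_edge p ghost_edge_sum[OF p, of \<alpha> \<beta>, where 'r = 'r] by (simp add: step_Vertex)
    next
      case False
      then have
        "(\<Sum>i=1..\<omega> \<alpha>. if i \<le> \<omega> \<beta> then letter_action (Edge \<beta> i) (step p (Ghost \<alpha> i)) else 0
          :: ('v, 'e) letter list \<Rightarrow>\<^sub>0 'r) = 0"
        by (intro sum.neutral) (auto simp: step_mismatch additive.zero[OF additive_letter_action])
      then show ?thesis using False by (auto simp: step_mismatch)
    qed
    finally show ?thesis .
  qed
qed

lemma action_word_scale: "action f (word_scale c g) = action (word_scale_right f c) g"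
  by (rule additive_eq_on_singles[where f = g and F = "\<lambda>g. action f (word_scale c g)"
        and G = "action (word_scale_right f c)"])
    (auto intro: additive_compose[OF additive_action additive_word_scale] additive_action
      simp: word_scale_right_word_scale_right)

text \<open>The elements annihilating every \<open>f\<close> form an ideal. Quantifying over all
  \<open>f\<close> is what gives closure on the left and under scalars: these operations only
  replace \<open>f\<close> by another function.\<close>

lemma action_leavitt_ideal:
  assumes "g \<in> leavitt_ideal E \<omega>"
  shows "action f g = 0"
proof -
  let ?K = "{g \<in> free_carrier (letters E \<omega>). \<forall>f. action f g = 0}"
  have "free_ring_ideal (letters E \<omega>) ?K"
    unfolding free_ring_ideal_iff
    by (auto simp: free_carrier_zero free_carrier_diff free_carrier_mult free_carrier_scale
        action_zero action_diff action_word_mult action_word_scale additive.zero[OF additive_action_left])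
  moreover have "leavitt_relations E \<omega> \<subseteq> ?K"
    using leavitt_relations_in_carrier action_leavitt_relations by auto
  ultimately have "leavitt_ideal E \<omega> \<subseteq> ?K"
    unfolding leavitt_ideal_def by (intro hull_minimal)
  then show ?thesis using assms by auto
qed

end

section \<open>Reduction modulo the ideal\<close>

lemma word_mult_single_right:
  "f \<star> Poly_Mapping.single w c = word_scale_right f c \<star> word w"
  by (rule additive_eq_on_singles[where f = f and F = "\<lambda>f. f \<star> Poly_Mapping.single w c"
        and G = "\<lambda>f. word_scale_right f c \<star> word w"])
    (auto intro: additive_word_mult_left additive_compose[OF additive_word_mult_left
      additive_word_scale_right])

lemma additive_diff_fun: "additive F \<Longrightarrow> additive G \<Longrightarrow> additive (\<lambda>x. F x - G x)"
  by (simp add: additive_def)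

context LV_graph
begin

section \<open>Closure properties of the ideal and congruences between words\<close>

lemma free_ring_ideal_leavitt_ideal: "free_ring_ideal (letters E \<omega>) (leavitt_ideal E \<omega>)"
  unfolding leavitt_ideal_def by (rule free_ring_ideal_hull) (rule leavitt_relations_in_carrier)

lemma leavitt_ideal_zero: "0 \<in> leavitt_ideal E \<omega>"
  and leavitt_ideal_diff: "f \<in> leavitt_ideal E \<omega> \<Longrightarrow> g \<in> leavitt_ideal E \<omega>
    \<Longrightarrow> f - g \<in> leavitt_ideal E \<omega>"
  and leavitt_ideal_mult_right: "f \<in> leavitt_ideal E \<omega> \<Longrightarrow> h \<in> free_carrier (letters E \<omega>)
    \<Longrightarrow> f \<star> h \<in> leavitt_ideal E \<omega>"
  and leavitt_ideal_mult_left: "f \<in> leavitt_ideal E \<omega> \<Longrightarrow> h \<in> free_carrier (letters E \<omega>)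
    \<Longrightarrow> h \<star> f \<in> leavitt_ideal E \<omega>"
  and leavitt_ideal_scale: "f \<in> leavitt_ideal E \<omega> \<Longrightarrow> word_scale c f \<in> leavitt_ideal E \<omega>"
  using free_ring_ideal_leavitt_ideal unfolding free_ring_ideal_iff by blast+

lemma leavitt_ideal_uminus: "f \<in> leavitt_ideal E \<omega> \<Longrightarrow> - f \<in> leavitt_ideal E \<omega>"
  using leavitt_ideal_diff[OF leavitt_ideal_zero, of f] by simp

lemma leavitt_ideal_add:
  "f \<in> leavitt_ideal E \<omega> \<Longrightarrow> g \<in> leavitt_ideal E \<omega> \<Longrightarrow> f + g \<in> leavitt_ideal E \<omega>"
  using leavitt_ideal_diff[of f "- g"] leavitt_ideal_uminus[of g] by simp

lemma leavitt_ideal_sum: "(\<And>i. i \<in> S \<Longrightarrow> F i \<in> leavitt_ideal E \<omega>) \<Longrightarrow> sum F S \<in> leavitt_ideal E \<omega>"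
  by (induction S rule: infinite_finite_induct) (auto simp: leavitt_ideal_zero leavitt_ideal_add)

lemma leavitt_ideal_relation: "\<rho> \<in> leavitt_relations E \<omega> \<Longrightarrow> \<rho> \<in> leavitt_ideal E \<omega>"
  unfolding leavitt_ideal_def by (rule subsetD[OF hull_subset])

lemma leavitt_ideal_diff_trans:
  "f - g \<in> leavitt_ideal E \<omega> \<Longrightarrow> g - h \<in> leavitt_ideal E \<omega> \<Longrightarrow> f - h \<in> leavitt_ideal E \<omega>"
  using leavitt_ideal_add[of "f - g" "g - h"] by simp

lemma leavitt_ideal_additiveI:
  assumes "additive F" "\<And>w c. w \<in> Poly_Mapping.keys h
    \<Longrightarrow> F (Poly_Mapping.single w c) \<in> leavitt_ideal E \<omega>"
  shows "F h \<in> leavitt_ideal E \<omega>"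
  by (subst poly_mapping_eq_sum_single, subst
    additive.sum[OF assms(1)]) (intro leavitt_ideal_sum assms(2))

lemma letter_range_relation:
  assumes "x \<in> letters E \<omega>"
  shows "word [x, Vertex (letter_range E x)] - word [x] \<in> leavitt_ideal E \<omega>"
proof -
  have "word [x, Vertex (letter_range E x)] - word [x] \<in> leavitt_relations E \<omega>"
  proof (cases x)
    case (Vertex v)
    then show ?thesis using assms leavitt_relations.vertices[of v E v] by (auto simp: letters_eq vertex_elem_def)
  next
    case (Edge \<alpha> i)
    then show ?thesis using assms leavitt_relations.edge_range[of \<alpha> E i \<omega>]
      by (auto simp: letters_eq vertex_elem_def edge_elem_def)
  next
    case (Ghost \<alpha> i)
    then show ?thesis using assms leavitt_relations.ghost_range[of \<alpha> E i \<omega>]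
      by (auto simp: letters_eq vertex_elem_def ghost_elem_def)
  qed
  then show ?thesis by (rule leavitt_ideal_relation)
qed

lemma letter_source_relation:
  assumes "x \<in> letters E \<omega>"
  shows "word [Vertex (letter_source E x), x] - word [x] \<in> leavitt_ideal E \<omega>"
proof -
  have "word [Vertex (letter_source E x), x] - word [x] \<in> leavitt_relations E \<omega>"
  proof (cases x)
    case (Vertex v)
    then show ?thesis using assms leavitt_relations.vertices[of v E v] by (auto simp: letters_eq vertex_elem_def)
  next
    case (Edge \<alpha> i)
    then show ?thesis using assms leavitt_relations.edge_source[of \<alpha> E i \<omega>]
      by (auto simp: letters_eq vertex_elem_def edge_elem_def)
  next
    case (Ghost \<alpha> i)
    then show ?thesis using assms leavitt_relations.ghost_source[of \<alpha> E i \<omega>]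
      by (auto simp: letters_eq vertex_elem_def ghost_elem_def)
  qed
  then show ?thesis by (rule leavitt_ideal_relation)
qed

lemma word_range_relation:
  assumes "u \<in> lists (letters E \<omega>)" "u \<noteq> []"
  shows "word (u @ [Vertex (letter_range E (last u))]) - word u \<in> leavitt_ideal E \<omega>"
proof (cases "butlast u = []")
  case True
  then have "u = [last u]" using assms by (metis append_butlast_last_id append_Nil)
  then show ?thesis using letter_range_relation[of "last u"] assms
    by (metis append_Cons append_Nil last_in_set in_lists_conv_set)
next
  case False
  have u: "butlast u \<in> lists (letters E \<omega>)" "last u \<in> letters E \<omega>" "u = butlast u @ [last u]"
    using assms by (auto dest: in_set_butlastD)
  have "word (butlast u) \<star> (word [last u, Vertex (letter_range E (last u))] - word [last u]) \<in> leavitt_ideal E \<omega>"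
    using u False by (intro leavitt_ideal_mult_left letter_range_relation free_carrier_single)
  moreover have "butlast u @ [last u, z] = u @ [z]" for z
    using append_butlast_last_id[OF assms(2)] by (metis append.assoc append_Cons append_Nil)
  ultimately show ?thesis using assms(2)
    by (simp add: word_mult_diff_right)
qed

lemma word_source_relation:
  assumes "u \<in> lists (letters E \<omega>)" "u \<noteq> []"
  shows "word (Vertex (letter_source E (hd u)) # u) - word u \<in> leavitt_ideal E \<omega>"
proof (cases u)
  case (Cons x w)
  show ?thesis
  proof (cases "w = []")
    case True
    then show ?thesis using Cons assms letter_source_relation[of x] by simp
  next
    case False
    have "(word [Vertex (letter_source E x), x] - word [x]) \<star> word w \<in> leavitt_ideal E \<omega>"
      using assms Cons False
        by (intro leavitt_ideal_mult_right letter_source_relation free_carrier_single) auto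
    then show ?thesis using Cons by (simp add: word_mult_diff_left)
  qed
qed (use assms in simp)

text \<open>Inserting the range of \<open>u\<close> and the source of \<open>w\<close> between the
  two words does not change the class, and the product of these two distinct vertices lies in the
  ideal.\<close>

lemma word_mismatch:
  assumes u: "u \<in> lists (letters E \<omega>)" "u \<noteq> []" and w: "w \<in> lists (letters E \<omega>)" "w \<noteq> []"
    and ne: "letter_range E (last u) \<noteq> letter_source E (hd w)"
  shows "word (u @ w) \<in> leavitt_ideal E \<omega>"
proof -
  let ?r = "letter_range E (last u)" and ?s = "letter_source E (hd w)"
  have rs: "?r \<in> verts E" "?s \<in> verts E"
    using u w by (auto intro!: letter_range_in_verts letter_source_in_verts)
  have "word [Vertex ?r, Vertex ?s] \<in> leavitt_ideal E \<omega>"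
    using leavitt_relations.vertices[OF rs] ne
    by (intro leavitt_ideal_relation) (simp add: vertex_elem_def)
  then have "word u \<star> word [Vertex ?r, Vertex ?s] \<star> word w \<in> leavitt_ideal E \<omega>"
    using u w by (intro leavitt_ideal_mult_right leavitt_ideal_mult_left free_carrier_single)
  moreover have "(word (u @ [Vertex ?r]) - word u) \<star> word (Vertex ?s # w) \<in> leavitt_ideal E \<omega>"
    using u w rs
      by (intro leavitt_ideal_mult_right word_range_relation free_carrier_single) (auto
        simp: letters_eq)
  moreover have "word u \<star> (word (Vertex ?s # w) - word w) \<in> leavitt_ideal E \<omega>"
    using u w by (intro leavitt_ideal_mult_left word_source_relation free_carrier_single)
  ultimately have "word u \<star> word [Vertex ?r, Vertex ?s] \<star> word w
      - (word (u @ [Vertex ?r]) - word u) \<star> word (Vertex ?s # w)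
      - word u \<star> (word (Vertex ?s # w) - word w) \<in> leavitt_ideal E \<omega>"
    by (intro leavitt_ideal_diff)
  then show ?thesis
    by (simp add: word_mult_diff_left word_mult_diff_right)
qed

text \<open>A forbidden word and its replacements are together the terms of length 2 of a single
  relation: (3) at the source of a chosen arc, or (4) with its term of index 1 split off.\<close>

lemma forbidden_relation:
  assumes xy: "x \<in> arrow_letters" "y \<in> arrow_letters" "letter_range E x = letter_source E y"
    "forbidden x y"
  shows "word [x, y] + (\<Sum>(x', y')\<in>replacements x y. word [x', y'])
    - (if cancels x y then word [Vertex (letter_source E x)]
      else 0) \<in> (leavitt_ideal E \<omega> :: (('v, 'e) letter list \<Rightarrow>\<^sub>0 'r::ring_1) set)"
    (is "?rel \<in> _")
proof -
  \<comment> \<open>Taking the empty prefix makes the sum formulas for \<open>reduct\<close>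
    available. The auxiliary \<open>word []\<close> lies outside the free ring but cancels.\<close>
  have neg: "(\<Sum>(x', y')\<in>replacements x y. word [x', y'])
     = (if cancels x y then word [] else 0) - (reduct [] x y :: ('v, 'e) letter list \<Rightarrow>\<^sub>0 'r)"
    by (simp add: reduct_def)
  from xy have "?rel \<in> leavitt_relations E \<omega>"
  proof (cases "(x, y)" rule: forbidden.cases)
    case (1 \<alpha> i \<beta> j)
    let ?v = "tail E \<alpha>"
    let ?W = "\<lambda>\<gamma>. if i \<le> \<omega> \<gamma> \<and> j \<le> \<omega> \<gamma> then word [Edge \<gamma> i, Ghost \<gamma> j] else 0
      :: (('v, 'e) letter list \<Rightarrow>\<^sub>0 'r)"
    have \<alpha>: "\<alpha> \<in> arcs E" "\<alpha> = \<beta>" "i \<in> {1..\<omega> \<alpha>}" "j \<in> {1..\<omega> \<alpha>}" using xy 1 by auto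
    have "(\<Sum>\<gamma>\<in>out_arcs E ?v. edge_elem \<omega> \<gamma> i \<star> ghost_elem \<omega> \<gamma> j)
      - (if i = j then vertex_elem ?v else 0) \<in> (leavitt_relations E \<omega> :: (('v, 'e) letter
        list \<Rightarrow>\<^sub>0 'r) set)"
      using \<alpha> weight_le_vertex_weight[of \<alpha>] not_sink_tail[of \<alpha>]
        by (intro leavitt_relations.edge_ghost) auto
    also have "(\<Sum>\<gamma>\<in>out_arcs E ?v. edge_elem \<omega> \<gamma> i \<star> ghost_elem \<omega> \<gamma> j) = (\<Sum>\<gamma>\<in>out_arcs E ?v. ?W \<gamma>)"
      by (simp add: edge_elem_mult_ghost_elem)
    also have "\<dots> = ?W \<alpha> + (\<Sum>\<gamma>\<in>out_arcs E ?v - {\<alpha>}. ?W \<gamma>)"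
      by (rule sum.remove) (use \<alpha> row_finite in auto)
    also have "(\<Sum>\<gamma>\<in>out_arcs E ?v - {\<alpha>}. ?W \<gamma>) = (\<Sum>(x', y')\<in>replacements x y. word [x', y'])"
      unfolding neg using 1 \<alpha> by (simp add: reduct_Edge_Ghost cong: if_cong)
    finally show ?thesis using 1 \<alpha> by (simp add: vertex_elem_def del: replacements.simps cong: if_cong)
  next
    case (2 \<alpha> i \<beta> j)
    let ?W = "\<lambda>i. if i \<le> \<omega> \<beta> then word [Ghost \<alpha> i, Edge \<beta> i] else 0
      :: (('v, 'e) letter list \<Rightarrow>\<^sub>0 'r)"
    have \<alpha>: "\<alpha> \<in> arcs E" "\<beta> \<in> arcs E" "i = 1" "j = 1" "1 \<le> \<omega> \<alpha>" "1 \<le> \<omega> \<beta>" using xy 2 by auto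
    have "(\<Sum>i=1..max (\<omega> \<alpha>) (\<omega> \<beta>). ghost_elem \<omega> \<alpha> i \<star> edge_elem \<omega> \<beta> i)
      - (if \<alpha> = \<beta> then vertex_elem (head E \<alpha>) else 0) \<in> (leavitt_relations E \<omega> :: (('v, 'e) letter
        list \<Rightarrow>\<^sub>0 'r) set)"
      using \<alpha> by (intro leavitt_relations.ghost_edge)
    also have "(\<Sum>i=1..max (\<omega> \<alpha>) (\<omega> \<beta>). ghost_elem \<omega> \<alpha> i \<star> edge_elem \<omega> \<beta> i) = (\<Sum>i=1..\<omega> \<alpha>. ?W i)"
      by (rule sum.mono_neutral_cong_right) (auto simp: ghost_elem_mult_edge_elem)
    also have "{1..\<omega> \<alpha>} = insert 1 {2..\<omega> \<alpha>}" using \<alpha> by auto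
    also have "(\<Sum>i\<in>insert 1 {2..\<omega> \<alpha>}. ?W i) = ?W 1 + (\<Sum>i=2..\<omega> \<alpha>. ?W i)"
      by simp
    also have "(\<Sum>i=2..\<omega> \<alpha>. ?W i) = (\<Sum>(x', y')\<in>replacements x y. word [x', y'])"
      unfolding neg using 2 by (simp add: reduct_Ghost_Edge cong: if_cong)
    finally show ?thesis using 2 \<alpha> by (simp add: vertex_elem_def del: replacements.simps cong: if_cong)
  qed auto
  then show ?thesis by (rule leavitt_ideal_relation)
qed

text \<open>Every branch of \<open>step\<close> is an application of the relations, so reducing does
  not leave the class of the word.\<close>

lemma word_snoc_step:
  assumes p: "normal p" and y: "y \<in> letters E \<omega>"
  shows "word (p @ [y]) - step p y \<in> (leavitt_ideal E \<omega>
    :: (('v, 'e) letter list \<Rightarrow>\<^sub>0 'r::ring_1) set)"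
proof -
  have pl: "p \<in> lists (letters E \<omega>)" "p \<noteq> []" using p normal_in_lists by auto
  from p y show ?thesis
  proof (cases rule: step_cases)
    case mismatch
    then show ?thesis using word_mismatch[OF pl, of "[y]"] y by (simp add: step_mismatch)
  next
    case Vertex
    then show ?thesis using word_range_relation[OF pl] p normal_range_in_verts[OF p] by (simp add: step_Vertex)
  next
    case composable
    then show ?thesis using p by (simp add: step_composable leavitt_ideal_zero)
  next
    case (forbidden q x)
    let ?v = "letter_source E x"
    let ?rel = "word [x, y] + (\<Sum>(x', y')\<in>replacements x y. word [x', y'])
      - (if cancels x y then word [Vertex ?v] else 0) :: (('v, 'e) letter list \<Rightarrow>\<^sub>0 'r)"
    have q: "q \<in> lists (letters E \<omega>)" "q \<noteq> []" "letter_range E (last q) = ?v"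
      using forbidden normal_in_lists by (auto simp: composable_def)
    have "word q \<star> ?rel \<in> leavitt_ideal E \<omega>"
      using forbidden q by (intro leavitt_ideal_mult_left forbidden_relation free_carrier_single)
    \<comment> \<open>Multiplying the relation by \<open>q\<close> leaves \<open>q\<close> followed
      by the vertex at which it ends; this congruence removes that vertex, as \<open>reduct\<close>
      does.\<close>
    moreover have
      "(if cancels x y then word (q @ [Vertex ?v]) - word q else 0) \<in> (leavitt_ideal E \<omega>
        :: (('v, 'e) letter list \<Rightarrow>\<^sub>0 'r) set)"
      using word_range_relation[OF q(1,2)] q(3) by (auto simp: leavitt_ideal_zero)
    ultimately have
      "word q \<star> ?rel + (if cancels x y then word (q @ [Vertex ?v]) - word q else 0) \<in> leavitt_ideal E \<omega>"
      by (rule leavitt_ideal_add)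
    also have "word q \<star> ?rel = word (p @ [y]) + (\<Sum>(x', y')\<in>replacements x y. word (q @ [x', y']))
      - (if cancels x y then word (q @ [Vertex ?v]) else 0)"
      using forbidden by (simp add: word_mult_diff_right word_mult_add_right word_mult_sum_right
        case_prod_unfold)
    also have "word (p @ [y]) + (\<Sum>(x', y')\<in>replacements x y. word (q @ [x', y']))
      - (if cancels x y then word (q @ [Vertex ?v]) else 0) + (if cancels x y then word (q @ [Vertex ?v]) - word q else 0)
      = word (p @ [y]) - step p y"
      using forbidden p by (auto simp: step_forbidden reduct_def)
    finally show ?thesis .
  qed
qed

section \<open>Supports under the action; the action computes products modulo the ideal\<close>

lemma keys_letter_action:
  assumes "w \<in> Poly_Mapping.keys (letter_action y f :: ('v, 'e) letter list \<Rightarrow>\<^sub>0 'r::ring_1)"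
  obtains p where "p \<in> Poly_Mapping.keys f"
    "w \<in> Poly_Mapping.keys (step p y :: ('v, 'e) letter list \<Rightarrow>\<^sub>0 'r)"
proof -
  have "w \<in> (\<Union>p\<in>Poly_Mapping.keys f. Poly_Mapping.keys (word_scale (Poly_Mapping.lookup f p) (step p y)))"
    using assms keys_sum unfolding letter_action_def by fast
  then show ?thesis using that keys_word_scale by fast
qed

lemma keys_letter_action_properties:
  assumes "w \<in> Poly_Mapping.keys (letter_action y f)"
  shows "normal w" "letter_range E (last w) = letter_range E y"
    "\<exists>p\<in>Poly_Mapping.keys f. hd w = hd p"
  using assms by (auto elim!: keys_letter_action dest!: keys_step)

lemma keys_word_action_normal:
  assumes "w \<in> Poly_Mapping.keys (word_action u f)" "\<And>p. p \<in> Poly_Mapping.keys f \<Longrightarrow> normal p"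
  shows "normal w"
  using assms
proof (induction u arbitrary: f)
  case (Cons y u)
  show ?case
    by (rule Cons.IH[of "letter_action y f"])
      (use Cons.prems(1) in \<open>auto dest: keys_letter_action_properties(1)\<close>)
qed simp

lemma hd_keys_word_action:
  assumes "w \<in> Poly_Mapping.keys (word_action u f)" "\<And>p. p \<in> Poly_Mapping.keys f \<Longrightarrow> hd p = x"
  shows "hd w = x"
  using assms
proof (induction u arbitrary: f)
  case (Cons y u)
  have "hd p = x" if "p \<in> Poly_Mapping.keys (letter_action y f)" for p
    using keys_letter_action_properties(3)[OF that] Cons.prems(2) by auto
  then show ?case using Cons.IH[of "letter_action y f"] Cons.prems(1) by simp
qed simp

lemma length_keys_word_action:
  fixes f :: "('v, 'e) letter list \<Rightarrow>\<^sub>0 'r::ring_1"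
  assumes "w \<in> Poly_Mapping.keys (word_action u f)" "\<And>p. p \<in> Poly_Mapping.keys f \<Longrightarrow> length p \<le> n"
  shows "length w \<le> n + length u"
  using assms
proof (induction u arbitrary: f n)
  case (Cons y u)
  have "length p \<le> Suc n" if p: "p \<in> Poly_Mapping.keys (letter_action y f)" for p
  proof -
    obtain p' where p': "p' \<in> Poly_Mapping.keys f"
      "p \<in> Poly_Mapping.keys (step p' y :: ('v, 'e) letter list \<Rightarrow>\<^sub>0 'r)"
      using keys_letter_action[OF p] by blast
    then show ?thesis using Cons.prems(2)[of p'] keys_step[OF p'(2)] by (auto split: if_splits)
  qed
  then show ?case using Cons.IH[of "letter_action y f" "Suc n"] Cons.prems(1) by simp
qed simp

lemma keys_action:
  assumes "w \<in> Poly_Mapping.keys (action f g)"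
  obtains u c where "u \<in> Poly_Mapping.keys g"
    "w \<in> Poly_Mapping.keys (word_action u (word_scale_right f c))"
proof -
  have "w \<in> (\<Union>u\<in>Poly_Mapping.keys g. Poly_Mapping.keys (word_action u (word_scale_right f (Poly_Mapping.lookup g u))))"
    using assms keys_sum unfolding action_def by fast
  then show ?thesis using that by fast
qed

lemma letter_action_cong:
  assumes f: "\<And>p. p \<in> Poly_Mapping.keys f \<Longrightarrow> normal p" and y: "y \<in> letters E \<omega>"
  shows "f \<star> word [y] - letter_action y f \<in> leavitt_ideal E \<omega>"
proof (rule leavitt_ideal_additiveI[where h = f and F = "\<lambda>f. f \<star> word [y] - letter_action y f"])
  show "additive (\<lambda>f. f \<star> word [y] - letter_action y f)"
    by (intro additive_diff_fun additive_word_mult_left additive_letter_action)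
  fix p and c :: 'a assume "p \<in> Poly_Mapping.keys f"
  then have "word_scale c (word (p @ [y]) - step p y) \<in> leavitt_ideal E \<omega>"
    using f y by (intro leavitt_ideal_scale word_snoc_step)
  then show
    "Poly_Mapping.single p c \<star> word [y] - letter_action y (Poly_Mapping.single p c) \<in> leavitt_ideal E \<omega>"
    by (simp add: word_scale_diff)
qed

text \<open>The induction goes through because \<open>letter_action\<close> yields only normal
  words, so the one-letter congruence applies again.\<close>

lemma word_action_cong:
  assumes "\<And>p. p \<in> Poly_Mapping.keys f \<Longrightarrow> normal p" "w \<in> lists (letters E \<omega>)" "w \<noteq> []"
  shows "f \<star> word w - word_action w f \<in> leavitt_ideal E \<omega>"
  using assms(3,2,1)
proof (induction w arbitrary: f rule: list_nonempty_induct)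
  case (single y)
  then show ?case using letter_action_cong[of f y] by simp
next
  case (cons y w)
  have "(f \<star> word [y] - letter_action y f) \<star> word w \<in> leavitt_ideal E \<omega>"
    using cons by (intro leavitt_ideal_mult_right letter_action_cong free_carrier_single) auto
  moreover have "letter_action y f \<star> word w - word_action w (letter_action y f) \<in> leavitt_ideal E \<omega>"
    using cons keys_letter_action_properties(1) by (intro cons.IH) auto
  moreover have "f \<star> word (y # w) = f \<star> word [y] \<star> word w"
    by (simp add: word_mult_assoc)
  ultimately show ?case
    using leavitt_ideal_diff_trans[of "f \<star> word [y] \<star> word w" "letter_action y f \<star> word w"]
    by (simp add: word_mult_diff_left)
qed

text \<open>The counterpart of \<open>action_leavitt_ideal\<close>: the ideal acts as zero, and
  acting agrees with multiplying up to the ideal. Together they allow elements outside the ideal to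
  be traded for nonzero combinations of normal words.\<close>

lemma action_cong:
  assumes f: "\<And>p. p \<in> Poly_Mapping.keys f \<Longrightarrow> normal p" and g: "g \<in> free_carrier (letters E \<omega>)"
  shows "f \<star> g - action f g \<in> leavitt_ideal E \<omega>"
proof (rule leavitt_ideal_additiveI[where h = g and F = "\<lambda>g. f \<star> g - action f g"])
  show "additive (\<lambda>g. f \<star> g - action f g)"
    by (intro additive_diff_fun additive_word_mult_right additive_action)
  fix w and c :: 'a assume "w \<in> Poly_Mapping.keys g"
  then have
    "word_scale_right f c \<star> word w - word_action w (word_scale_right f c) \<in> leavitt_ideal E \<omega>"
    using f g
      by (intro word_action_cong) (auto simp: free_carrier_iff
        dest: subsetD[OF keys_word_scale_right])
  then show "f \<star> Poly_Mapping.single w c - action f (Poly_Mapping.single w c) \<in> leavitt_ideal E \<omega>"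
    by (simp add: word_mult_single_right[of f w c])
qed

section \<open>Local units\<close>

lemma left_local_unit:
  fixes h :: "('v, 'e) letter list \<Rightarrow>\<^sub>0 'r::ring_1"
  assumes h: "h \<in> free_carrier (letters E \<omega>)" "h \<notin> leavitt_ideal E \<omega>"
  obtains u where "u \<in> verts E" "vertex_elem u \<star> h \<notin> leavitt_ideal E \<omega>"
proof -
  let ?S = "(\<lambda>w. letter_source E (hd w)) ` Poly_Mapping.keys h"
  have S: "?S \<subseteq> verts E"
  proof (rule image_subsetI)
    fix w assume "w \<in> Poly_Mapping.keys h"
    then have "w \<in> lists (letters E \<omega>)" "w \<noteq> []" using h by (auto simp: free_carrier_iff)
    then show "letter_source E (hd w) \<in> verts E" by (auto intro!: letter_source_in_verts)
  qed
  \<comment> \<open>Only finitely many vertices are sources of words in \<open>h\<close>, and their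
    sum is a left unit for \<open>h\<close> modulo the ideal: on each word one vertex acts as the
    identity and the others give a mismatch. Some summand must then lie outside the ideal.\<close>
  have "h - (\<Sum>u\<in>?S. vertex_elem u \<star> h) \<in> leavitt_ideal E \<omega>"
  proof (rule leavitt_ideal_additiveI[where h = h and F = "\<lambda>h. h - (\<Sum>u\<in>?S. vertex_elem u \<star> h)"])
    show "additive (\<lambda>h'. h' - (\<Sum>u\<in>?S. vertex_elem u \<star> h'))"
      by (intro additive_diff_fun additive_fun_sum additive_word_mult_right) (simp
        add: additive_def)
    fix w and c :: 'r assume w: "w \<in> Poly_Mapping.keys h"
    then have wl: "w \<in> lists (letters E \<omega>)" "w \<noteq> []" using h by (auto simp: free_carrier_iff)
    let ?s = "letter_source E (hd w)"
    let ?W = "\<lambda>u. word (Vertex u # w) :: ('v, 'e) letter list \<Rightarrow>\<^sub>0 'r"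
    have "?W u \<in> leavitt_ideal E \<omega>" if "u \<in> ?S - {?s}" for u
      using word_mismatch[of "[Vertex u]" w] that wl S by (auto simp: letters_eq)
    then have "(\<Sum>u\<in>?S - {?s}. ?W u) \<in> leavitt_ideal E \<omega>"
      by (intro leavitt_ideal_sum)
    then have "(?W ?s - word w) + (\<Sum>u\<in>?S - {?s}. ?W u) \<in> leavitt_ideal E \<omega>"
      by (intro leavitt_ideal_add word_source_relation wl)
    moreover have "(\<Sum>u\<in>?S. ?W u) = ?W ?s + (\<Sum>u\<in>?S - {?s}. ?W u)"
      by (rule sum.remove) (use w in auto)
    ultimately have "(\<Sum>u\<in>?S. ?W u) - word w \<in> leavitt_ideal E \<omega>"
      by (simp add: algebra_simps)
    then have "word_scale c (- ((\<Sum>u\<in>?S. ?W u) - word w)) \<in> leavitt_ideal E \<omega>"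
      by (intro leavitt_ideal_scale leavitt_ideal_uminus)
    then show
      "Poly_Mapping.single w c - (\<Sum>u\<in>?S. vertex_elem u \<star> Poly_Mapping.single w c) \<in> leavitt_ideal E \<omega>"
      by (simp add: word_scale_diff additive.sum[OF additive_word_scale] vertex_elem_def)
  qed
  then have "\<not> (\<forall>u\<in>?S. vertex_elem u \<star> h \<in> leavitt_ideal E \<omega>)"
    using h(2) leavitt_ideal_sum[of ?S "\<lambda>u. vertex_elem u \<star> h"]
      leavitt_ideal_add[of "h - (\<Sum>u\<in>?S. vertex_elem u \<star> h)" "\<Sum>u\<in>?S. vertex_elem u \<star> h"] by auto
  then show ?thesis using that S by auto
qed

lemma right_local_unit:
  fixes h :: "('v, 'e) letter list \<Rightarrow>\<^sub>0 'r::ring_1"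
  assumes h: "h \<in> free_carrier (letters E \<omega>)" "h \<notin> leavitt_ideal E \<omega>"
  obtains u where "u \<in> verts E" "h \<star> vertex_elem u \<notin> leavitt_ideal E \<omega>"
proof -
  let ?S = "(\<lambda>w. letter_range E (last w)) ` Poly_Mapping.keys h"
  have S: "?S \<subseteq> verts E"
  proof (rule image_subsetI)
    fix w assume "w \<in> Poly_Mapping.keys h"
    then have "w \<in> lists (letters E \<omega>)" "w \<noteq> []" using h by (auto simp: free_carrier_iff)
    then show "letter_range E (last w) \<in> verts E" by (auto intro!: letter_range_in_verts)
  qed
  have "h - (\<Sum>u\<in>?S. h \<star> vertex_elem u) \<in> leavitt_ideal E \<omega>"
  proof (rule leavitt_ideal_additiveI[where h = h and F = "\<lambda>h. h - (\<Sum>u\<in>?S. h \<star> vertex_elem u)"])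
    show "additive (\<lambda>h'. h' - (\<Sum>u\<in>?S. h' \<star> vertex_elem u))"
      by (intro additive_diff_fun additive_fun_sum additive_word_mult_left) (simp add: additive_def)
    fix w and c :: 'r assume w: "w \<in> Poly_Mapping.keys h"
    then have wl: "w \<in> lists (letters E \<omega>)" "w \<noteq> []" using h by (auto simp: free_carrier_iff)
    let ?s = "letter_range E (last w)"
    let ?W = "\<lambda>u. word (w @ [Vertex u]) :: ('v, 'e) letter list \<Rightarrow>\<^sub>0 'r"
    have "?W u \<in> leavitt_ideal E \<omega>" if "u \<in> ?S - {?s}" for u
      using word_mismatch[of w "[Vertex u]"] that wl S by (auto simp: letters_eq)
    then have "(\<Sum>u\<in>?S - {?s}. ?W u) \<in> leavitt_ideal E \<omega>"
      by (intro leavitt_ideal_sum)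
    then have "(?W ?s - word w) + (\<Sum>u\<in>?S - {?s}. ?W u) \<in> leavitt_ideal E \<omega>"
      by (intro leavitt_ideal_add word_range_relation wl)
    moreover have "(\<Sum>u\<in>?S. ?W u) = ?W ?s + (\<Sum>u\<in>?S - {?s}. ?W u)"
      by (rule sum.remove) (use w in auto)
    ultimately have "(\<Sum>u\<in>?S. ?W u) - word w \<in> leavitt_ideal E \<omega>"
      by (simp add: algebra_simps)
    then have "word_scale c (- ((\<Sum>u\<in>?S. ?W u) - word w)) \<in> leavitt_ideal E \<omega>"
      by (intro leavitt_ideal_scale leavitt_ideal_uminus)
    then show
      "Poly_Mapping.single w c - (\<Sum>u\<in>?S. Poly_Mapping.single w c \<star> vertex_elem u) \<in> leavitt_ideal E \<omega>"
      by (simp add: word_scale_diff additive.sum[OF additive_word_scale] vertex_elem_def)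
  qed
  then have "\<not> (\<forall>u\<in>?S. h \<star> vertex_elem u \<in> leavitt_ideal E \<omega>)"
    using h(2) leavitt_ideal_sum[of ?S "\<lambda>u. h \<star> vertex_elem u"]
      leavitt_ideal_add[of "h - (\<Sum>u\<in>?S. h \<star> vertex_elem u)" "\<Sum>u\<in>?S. h \<star> vertex_elem u"] by auto
  then show ?thesis using that S by auto
qed

end

section \<open>Leading coefficients of products\<close>

context LV_graph
begin

text \<open>
  \<open>leads_to x y x' y'\<close>: the word \<open>x'y'\<close> occurs in the part of length 2 of the normal form of \<open>xy\<close>.
\<close>

definition leads_to ::
    "('v, 'e) letter \<Rightarrow> ('v, 'e) letter \<Rightarrow> ('v, 'e) letter \<Rightarrow> ('v, 'e) letter \<Rightarrow> bool" where
  "leads_to x y x' y' \<longleftrightarrow> (if forbidden x y then (x', y') \<in> replacements x y else x' = x \<and> y' = y)"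

text \<open>Forbidden pairs and replacement pairs are all of this shape, so a pair that is not
  diagonal arises from itself alone. Only families consisting entirely of diagonal pairs need a
  further argument.\<close>

fun diagonal :: "('v, 'e) letter \<Rightarrow> ('v, 'e) letter \<Rightarrow> bool" where
  "diagonal (Edge \<alpha> i) (Ghost \<beta> j) \<longleftrightarrow> \<alpha> = \<beta>"
| "diagonal (Ghost \<alpha> i) (Edge \<beta> j) \<longleftrightarrow> i = j"
| "diagonal _ _ \<longleftrightarrow> False"

lemma leads_to_not_diagonal: "\<not> diagonal x' y' \<Longrightarrow> leads_to x y x' y' \<longleftrightarrow> x' = x \<and> y' = y"
  by (cases "(x, y)" rule: forbidden.cases) (auto simp: leads_to_def)

text \<open>
  Here the two hypotheses on an LV-graph enter: if all pairs are forbidden, a second arc of maximal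
  weight, respectively the index 2, yields a replacement word that comes from only one pair.
\<close>

lemma unique_leading_pair:
  assumes X: "X \<noteq> {}" "\<And>x. x \<in> X \<Longrightarrow> x \<in> arrow_letters \<and> letter_range E x = v"
    and Y: "Y \<noteq> {}" "\<And>y. y \<in> Y \<Longrightarrow> y \<in> arrow_letters \<and> letter_source E y = v"
  obtains x y x' y' where "x \<in> X" "y \<in> Y" "leads_to x y x' y'"
    "\<And>x2 y2. x2 \<in> X \<Longrightarrow> y2 \<in> Y \<Longrightarrow> leads_to x2 y2 x' y' \<Longrightarrow> x2 = x \<and> y2 = y"
proof (cases "\<exists>x\<in>X. \<exists>y\<in>Y. \<not> diagonal x y")
  case True
  then show ?thesis using that leads_to_not_diagonal by metis
next
  case False
  then have diag: "diagonal x y" if "x \<in> X" "y \<in> Y" for x y using that by auto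
  obtain x y where xy: "x \<in> X" "y \<in> Y" using X Y by auto
  \<comment> \<open>Two rigid situations are left: edges in \<open>X\<close> and ghosts in
    \<open>Y\<close> all of one arc, or ghosts in \<open>X\<close> and edges in \<open>Y\<close> all
    of one index. In each of them either all pairs are forbidden or none is.\<close>
  from diag[OF xy] show ?thesis
  proof (cases "(x, y)" rule: diagonal.cases)
    case (1 \<alpha> i \<beta> j)
    then have x: "x = Edge \<alpha> i" and y: "y = Ghost \<alpha> j" using diag[OF xy] by auto
    have \<alpha>: "\<alpha> \<in> arcs E" "i \<le> \<omega> \<alpha>" "j \<le> \<omega> \<alpha>" using X(2)[OF xy(1)] Y(2)[OF xy(2)] x y by auto
    have X': "\<exists>i'. x2 = Edge \<alpha> i'" if "x2 \<in> X" for x2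
      using diag[OF that xy(2)] unfolding y by (cases x2) auto
    have Y': "\<exists>j'. y2 = Ghost \<alpha> j'" if "y2 \<in> Y" for y2
      using diag[OF xy(1) that] unfolding x by (cases y2) auto
    show ?thesis
    proof (cases "\<alpha> = special (tail E \<alpha>)")
      case True
      obtain \<gamma> where \<gamma>: "\<gamma> \<in> out_arcs E (tail E \<alpha>)" "\<omega> \<gamma> = vertex_weight E \<omega> (tail E \<alpha>)" "\<gamma> \<noteq> \<alpha>"
        using max_weight_arc_exists[of "tail E \<alpha>" \<alpha>] \<alpha> not_sink_tail by auto
      show ?thesis
      \<comment> \<open>Since \<gamma> has maximal weight, both indices exist on it. The word keeps
        i and j, and these determine the pair because the arc is common to the whole family.\<close>
      proof (rule that[OF xy, of "Edge \<gamma> i" "Ghost \<gamma> j"])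
        show "leads_to x y (Edge \<gamma> i) (Ghost \<gamma> j)"
          using True \<gamma> \<alpha> weight_le_vertex_weight[of \<alpha>] unfolding x y by (auto simp: leads_to_def)
        show "x2 = x \<and> y2 = y" if "x2 \<in> X" "y2 \<in> Y" "leads_to x2 y2 (Edge \<gamma> i) (Ghost \<gamma> j)"
          for x2 y2
          using X'[OF that(1)] Y'[OF that(2)] that(3) True unfolding x y
            by (auto simp: leads_to_def)
      qed
    next
      case False
      show ?thesis
      proof (rule that[OF xy, of x y])
        show "leads_to x y x y"
          using False unfolding x y by (auto simp: leads_to_def)
        show "x2 = x \<and> y2 = y" if "x2 \<in> X" "y2 \<in> Y" "leads_to x2 y2 x y" for x2 y2
          using X'[OF that(1)] Y'[OF that(2)] that(3) False unfolding x y
            by (auto simp: leads_to_def)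
      qed
    qed
  next
    case (2 \<alpha> i \<beta> j)
    then have x: "x = Ghost \<alpha> i" and y: "y = Edge \<beta> i" using diag[OF xy] by auto
    have \<alpha>: "\<alpha> \<in> arcs E" "\<beta> \<in> arcs E" using X(2)[OF xy(1)] Y(2)[OF xy(2)] x y by auto
    have X': "\<exists>\<alpha>'. x2 = Ghost \<alpha>' i" if "x2 \<in> X" for x2
      using diag[OF that xy(2)] unfolding y by (cases x2) auto
    have Y': "\<exists>\<beta>'. y2 = Edge \<beta>' i" if "y2 \<in> Y" for y2
      using diag[OF xy(1) that] unfolding x by (cases y2) auto
    show ?thesis
    proof (cases "i = 1")
      case True
      show ?thesis
      \<comment> \<open>All weights are at least 2, so index 2 is available on both arcs. The word
        keeps both arcs, and these determine the pair because the index is 1 throughout the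
        family.\<close>
      proof (rule that[OF xy, of "Ghost \<alpha> 2" "Edge \<beta> 2"])
        show "leads_to x y (Ghost \<alpha> 2) (Edge \<beta> 2)"
          using True \<alpha> weight_ge_2 unfolding x y by (auto simp: leads_to_def)
        show "x2 = x \<and> y2 = y" if "x2 \<in> X" "y2 \<in> Y" "leads_to x2 y2 (Ghost \<alpha> 2) (Edge \<beta> 2)"
          for x2 y2
          using X'[OF that(1)] Y'[OF that(2)] that(3) True unfolding x y
            by (auto simp: leads_to_def)
      qed
    next
      case False
      show ?thesis
      proof (rule that[OF xy, of x y])
        show "leads_to x y x y"
          using False unfolding x y by (auto simp: leads_to_def)
        show "x2 = x \<and> y2 = y" if "x2 \<in> X" "y2 \<in> Y" "leads_to x2 y2 x y" for x2 y2
          using X'[OF that(1)] Y'[OF that(2)] that(3) False unfolding x y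
            by (auto simp: leads_to_def)
      qed
    qed
  qed auto
qed

lemma word_action_normal:
  "p \<noteq> [] \<Longrightarrow> normal (p @ q) \<Longrightarrow> word_action q (word p) = word (p @ q)"
proof (induction q arbitrary: p)
  case (Cons y q)
  have "normal p" "y \<in> arrow_letters" "composable (last p) y"
    using Cons.prems by (auto simp: normal_append)
  then show ?case using Cons.IH[of "p @ [y]"] Cons.prems by (simp add: step_composable)
qed simp

lemma word_action_Vertex:
  assumes "normal p" "letter_range E (last p) = v"
  shows "word_action (Vertex v # q) (word p) = word_action q (word p)"
  using assms normal_range_in_verts[OF assms(1)] by (simp add: step_Vertex)

lemma normal_join:
  assumes p: "normal (p @ [x])" and q: "normal (Vertex v # y # q)" and xy: "composable x y"
  shows "normal (p @ [x, y] @ q)"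
proof -
  have "set (y # q) \<subseteq> arrow_letters" "successively composable (y # q)"
    using q by (auto simp: normal_def successively_Cons)
  then have "normal ((p @ [x]) @ y # q)"
    using p xy by (subst normal_append) auto
  then show ?thesis by simp
qed

text \<open>On words of this greatest length only the junction \<open>x y\<close> matters: if it is
  allowed, the words are concatenated; if not, it is rewritten once, each replacement entering with
  coefficient -1, and everything else in the result is shorter.\<close>

lemma lookup_word_action_top:
  assumes p: "normal (p @ [x])" and x: "x \<in> arrow_letters" "letter_range E x = v"
    and q: "normal (Vertex v # y # q)"
    and len: "length P = length p" "length Q = length q"
  shows "Poly_Mapping.lookup (word_action (Vertex v # y # q) (word (p @ [x]))) (P @ [x', y'] @ Q) =
    (if p = P \<and> q = Q \<and> leads_to x y x' y' then
      if forbidden x y then - 1 else 1 else 0 :: 'r::ring_1)"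
proof -
  have y: "y \<in> arrow_letters" "letter_source E y = v"
    using q by (auto simp: normal_def composable_def)
  have p0: "p \<noteq> []" using p x by (auto simp: normal_def)
  \<comment> \<open>The prescribed lengths place the two middle letters at the same positions, so
    the factorisation can be read off.\<close>
  have eq: "p @ [a, b] @ q = P @ [x', y'] @ Q \<longleftrightarrow> p = P \<and> q = Q \<and> x' = a \<and> y' = b" for a b
    using len by auto
  have act: "word_action (Vertex v # y # q) (word (p @ [x])) = word_action q (step (p @ [x]) y)"
    using word_action_Vertex[OF p, of v "y # q"] x by simp
  show ?thesis
  proof (cases "forbidden x y")
    case False
    then have c: "composable x y" using x y by (simp add: composable_def)
    have "word_action (Vertex v # y # q) (word (p @ [x])) = word_action q (word ((p @ [x]) @ [y]))"
      using p y c unfolding act by (subst step_composable) auto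
    also have "\<dots> = (word (p @ [x, y] @ q) :: ('v, 'e) letter list \<Rightarrow>\<^sub>0 'r)"
      using normal_join[OF p q c] by (subst word_action_normal) auto
    finally have
      "Poly_Mapping.lookup (word_action (Vertex v # y # q) (word (p @ [x]))) (P @ [x', y'] @ Q)
      = Poly_Mapping.lookup (word (p @ [x, y] @ q) :: ('v, 'e) letter list \<Rightarrow>\<^sub>0 'r) (P @ [x',
        y'] @ Q)"
      by (rule arg_cong)
    then show ?thesis
      using False eq[of x y] by (simp only: lookup_single when_def leads_to_def) simp
  next
    case True
    \<comment> \<open>The letter \<open>b\<close> forbids the same successors as \<open>y\<close>,
      and \<open>y # q\<close> is part of a normal word; so \<open>q\<close> is appended without any
      reduction.\<close>
    have repl: "word_action q (word (p @ [a, b])) = word (p @ [a, b] @ q)"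
      if ab: "(a, b) \<in> replacements x y" for a b
    proof -
      note r = replacements_properties[OF x(1) y(1) _ True ab]
      have n: "normal ((p @ [a]) @ [b])"
        using normal_replacement[OF p x(1) y(1) _ True ab] x y by simp
      have "successively composable (b # q)"
        using q r x y by (cases q) (auto simp: normal_def composable_def)
      then have "normal ((p @ [a, b]) @ q)"
        using n q by (subst normal_append) (auto simp: successively_Cons normal_def)
      then show ?thesis by (subst word_action_normal) auto
    qed
    let ?T = "P @ [x', y'] @ Q"
    let ?C = "if cancels x y then word_action q (word p) else 0 :: ('v, 'e) letter list \<Rightarrow>\<^sub>0 'r"
    have "word_action (Vertex v # y # q) (word (p @ [x])) = word_action q (reduct p x y)"
      using p x y True unfolding act by (simp add: step_forbidden)
    also have "\<dots> = ?C - (\<Sum>z\<in>replacements x y. word_action q (word (p @ [fst z, snd z])))"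
      by (simp add: reduct_def additive.diff[OF additive_word_action]
        additive.sum[OF additive_word_action]
        additive.zero[OF additive_word_action] case_prod_unfold)
    also have "(\<Sum>z\<in>replacements x y. word_action q (word (p @ [fst z, snd z])))
        = (\<Sum>z\<in>replacements x y. word (p @ [fst z, snd z] @ q) :: ('v, 'e) letter list \<Rightarrow>\<^sub>0 'r)"
      by (intro sum.cong refl repl) simp
    finally have "Poly_Mapping.lookup (word_action (Vertex v # y # q) (word (p @ [x]))) ?T
      = Poly_Mapping.lookup ?C ?T - (\<Sum>z\<in>replacements x y.
        if p @ [fst z, snd z] @ q = ?T then 1 else 0)"
      by (simp add: lookup_minus lookup_sum lookup_single when_def del: append_eq_append_conv)
    \<comment> \<open>After a cancellation at most \<open>length p + length q\<close> letters
      remain, two fewer than in \<open>?T\<close>.\<close>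
    moreover have "Poly_Mapping.lookup ?C ?T = 0"
    proof -
      have "?T \<notin> Poly_Mapping.keys (word_action q (word p) :: ('v, 'e) letter list \<Rightarrow>\<^sub>0 'r)"
        using length_keys_word_action[of ?T q "word p :: ('v, 'e) letter list \<Rightarrow>\<^sub>0 'r"
          "length p"] len by auto
      then show ?thesis by (auto simp: in_keys_iff)
    qed
    moreover have "(\<Sum>z\<in>replacements x y. if p @ [fst z, snd z] @ q = ?T then 1 else 0 :: 'r)
      = (\<Sum>z\<in>replacements x y. if z = (x', y') then if p = P \<and> q = Q then 1 else 0 else 0)"
      unfolding eq by (intro sum.cong) (auto simp: prod_eq_iff)
    moreover have "\<dots> = (if p = P \<and> q = Q \<and> (x', y') \<in> replacements x y then 1 else 0)"
      using finite_replacements[OF x(1)] by (simp add: sum.delta)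
    ultimately show ?thesis using True by (simp add: leads_to_def)
  qed
qed

lemma lookup_action:
  "Poly_Mapping.lookup (action f g) t = (\<Sum>(q, p)\<in>Poly_Mapping.keys g \<times> Poly_Mapping.keys f.
     Poly_Mapping.lookup f p * Poly_Mapping.lookup g q * Poly_Mapping.lookup (word_action q (word
       p)) t)"
proof -
  have "word_action q (word_scale_right f c) =
      (\<Sum>p\<in>Poly_Mapping.keys f. word_scale (Poly_Mapping.lookup f p * c) (word_action q (word
        p)))" for q c
  proof -
    have "word_scale_right f c
      = (\<Sum>p\<in>Poly_Mapping.keys f. word_scale (Poly_Mapping.lookup f p * c) (word p))"
      by (subst poly_mapping_eq_sum_single[of f]) (simp
        add: additive.sum[OF additive_word_scale_right])
    then show ?thesis
      by (simp only: additive.sum[OF additive_word_action] word_action_scale)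
  qed
  then show ?thesis
    by (simp add: action_def lookup_sum sum.cartesian_product case_prod_unfold)
qed

lemma normal_eq_Vertex:
  assumes "normal p" "length p \<le> 1"
  shows "\<exists>v\<in>verts E. p = [Vertex v]"
  using assms by (cases p) (auto simp: normal_def)

text \<open>It suffices to find a word t to which only one pair of words from \<open>f\<close> and
  \<open>g\<close> contributes, with coefficient 1 or -1: the coefficient at t is then a product of
  nonzero elements. To find it, a prefix P and a suffix Q are fixed by words of maximal length, and
  only the two letters at the junction vary.\<close>

lemma action_nonzero:
  fixes f g :: "('v, 'e) letter list \<Rightarrow>\<^sub>0 'r::ring_1_no_zero_divisors"
  assumes f: "f \<noteq> 0" "\<And>p. p \<in> Poly_Mapping.keys f \<Longrightarrow> normal p \<and> letter_range E (last p) = v"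
    and g: "g \<noteq> 0" "\<And>q. q \<in> Poly_Mapping.keys g \<Longrightarrow> normal q \<and> hd q = Vertex v"
  shows "action f g \<noteq> 0"
proof -
  let ?F = "Poly_Mapping.keys f" and ?G = "Poly_Mapping.keys g"
  define m where "m = Max (length ` ?F)"
  define n where "n = Max (length ` ?G)"
  have "?F \<noteq> {}" "?G \<noteq> {}" using f(1) g(1) by auto
  then have "m \<in> length ` ?F" "n \<in> length ` ?G"
    unfolding m_def n_def by (intro Max_in; simp)+
  then obtain p0 q0 where p0: "p0 \<in> ?F" "length p0 = m" and q0: "q0 \<in> ?G" "length q0 = n" by auto
  have le: "p \<in> ?F \<Longrightarrow> length p \<le> m" "q \<in> ?G \<Longrightarrow> length q \<le> n" for p q
    unfolding m_def n_def by auto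
  have nz: "Poly_Mapping.lookup f p * Poly_Mapping.lookup g q \<noteq> 0" if "p \<in> ?F" "q \<in> ?G" for p q
    using that by (auto simp: in_keys_iff)
  have Vq: "\<exists>q'. q = Vertex v # q'" if "q \<in> ?G" for q
    using g(2)[OF that] by (cases q) auto
  have "\<exists>p\<in>?F. \<exists>q\<in>?G. \<exists>t. Poly_Mapping.lookup (word_action q (word p)) t \<in> {1, - 1 :: 'r} \<and>
      (\<forall>p2\<in>?F. \<forall>q2\<in>?G. Poly_Mapping.lookup (word_action q2 (word p2)) t \<noteq> (0 :: 'r) \<longrightarrow> p2 = p \<and>
        q2 = q)"
  proof -
    \<comment> \<open>The initial vertex counts in the length, so length at most 1 means the vertex
      v alone, which changes nothing. A junction of two arrows exists only from length 2 on, on both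
      sides.\<close>
    consider "m \<le> 1" | "n \<le> 1" | "2 \<le> m" "2 \<le> n" by linarith
    then show ?thesis
    proof cases
      case 1
      have F: "p = [Vertex v]" if "p \<in> ?F" for p
        using normal_eq_Vertex[of p] f(2)[OF that] le(1)[OF that] 1 by auto
      have W: "word_action q (word [Vertex v]) = (word q :: ('v, 'e) letter list \<Rightarrow>\<^sub>0 'r)"
        if q: "q \<in> ?G" for q
      proof -
        obtain q' where q': "q = Vertex v # q'" using Vq[OF q] by blast
        have "v \<in> verts E" using g(2)[OF that] by (auto simp: normal_def)
        then have
          "word_action q (word [Vertex v])
            = (word_action q' (word [Vertex v]) :: ('v, 'e) letter list \<Rightarrow>\<^sub>0 'r)"
          unfolding q' by (intro word_action_Vertex) auto
        then show ?thesis
          using word_action_normal[of "[Vertex v]" q'] g(2)[OF that] q' by simp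
      qed
      have L: "Poly_Mapping.lookup (word_action q2 (word p2)) q0 = (if q2 = q0 then 1 else 0 :: 'r)"
        if "p2 \<in> ?F" "q2 \<in> ?G" for p2 q2
        using F[OF that(1)] W[OF that(2)] by (simp add: lookup_single when_def)
      show ?thesis
        by (rule bexI[OF _ p0(1)], rule bexI[OF _ q0(1)], rule exI[of _ q0])
          (use p0(1) q0(1) F L in \<open>auto split: if_splits\<close>)
    next
      case 2
      have G: "q = [Vertex v]" if "q \<in> ?G" for q
        using normal_eq_Vertex[of q] g(2)[OF that] le(2)[OF that] 2 by auto
      have W: "word_action [Vertex v] (word p) = (word p :: ('v, 'e) letter list \<Rightarrow>\<^sub>0 'r)"
        if "p \<in> ?F" for p
        using word_action_Vertex[of p v "[]"] f(2)[OF that] by simp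
      have L: "Poly_Mapping.lookup (word_action q2 (word p2)) p0 = (if p2 = p0 then 1 else 0 :: 'r)"
        if "p2 \<in> ?F" "q2 \<in> ?G" for p2 q2
        using G[OF that(2)] W[OF that(1)] by (simp add: lookup_single when_def)
      show ?thesis
        by (rule bexI[OF _ p0(1)], rule bexI[OF _ q0(1)], rule exI[of _ p0])
          (use p0(1) q0(1) G L in \<open>auto split: if_splits\<close>)
    next
      case 3
      have snoc: "\<exists>p' x. p = p' @ [x] \<and> x \<in> arrow_letters \<and> letter_range E x = v"
        if "p \<in> ?F" "length p = m" for p
      proof -
        have "normal p" using f(2)[OF that(1)] by simp
        then show ?thesis
          using f(2)[OF that(1)] that 3 by (cases rule: normal_last_cases) auto
      qed
      have cons: "\<exists>y q'. q = Vertex v # y # q' \<and> y \<in> arrow_letters \<and> letter_source E y = v"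
        if q: "q \<in> ?G" "length q = n" for q
      proof -
        obtain q1 where "q = Vertex v # q1" using Vq[OF q(1)] by blast
        then show ?thesis using g(2)[OF that(1)] that 3 by (cases q1) (auto simp: normal_def composable_def)
      qed
      obtain P x0 where P: "p0 = P @ [x0]" using snoc[OF p0] by auto
      obtain Q y0 where Q: "q0 = Vertex v # y0 # Q" using cons[OF q0] by auto
      let ?X = "{x. P @ [x] \<in> ?F}" and ?Y = "{y. Vertex v # y # Q \<in> ?G}"
      have X: "x \<in> arrow_letters \<and> letter_range E x = v" if "x \<in> ?X" for x
        using snoc[of "P @ [x]"] that p0 P by auto
      have Y: "y \<in> arrow_letters \<and> letter_source E y = v" if "y \<in> ?Y" for y
        using cons[of "Vertex v # y # Q"] that q0 Q by auto
      have ne: "?X \<noteq> {}" "?Y \<noteq> {}" using p0 q0 P Q by auto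
      obtain x y x' y' where xy: "x \<in> ?X" "y \<in> ?Y" "leads_to x y x' y'"
        and uniq: "\<And>x2 y2. x2 \<in> ?X \<Longrightarrow> y2 \<in> ?Y \<Longrightarrow> leads_to x2 y2 x' y' \<Longrightarrow> x2 = x \<and> y2 = y"
        using unique_leading_pair[OF ne(1) X ne(2) Y] by blast
      let ?t = "P @ [x', y'] @ Q"
      have "Poly_Mapping.lookup (word_action (Vertex v # y # Q) (word (P @ [x]))) ?t \<in> {1, - 1 :: 'r}"
        using xy f(2) g(2) X[OF xy(1)] by (subst lookup_word_action_top) auto
      moreover have "p2 = P @ [x] \<and> q2 = Vertex v # y # Q"
        if p2: "p2 \<in> ?F" and q2: "q2 \<in> ?G"
          and nz: "Poly_Mapping.lookup (word_action q2 (word p2)) ?t \<noteq> (0 :: 'r)" for p2 q2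
      proof -
        obtain q2' where q2': "q2 = Vertex v # q2'" using Vq[OF q2] by blast
        have "word_action q2 (word p2) = (word_action q2' (word p2) :: ('v, 'e) letter list \<Rightarrow>\<^sub>0 'r)"
          unfolding q2' using f(2)[OF p2] by (intro word_action_Vertex) auto
        then have
          "?t \<in> Poly_Mapping.keys (word_action q2' (word p2) :: ('v, 'e) letter list \<Rightarrow>\<^sub>0 'r)"
          using nz by (simp add: in_keys_iff)
        \<comment> \<open>Dropping the vertex at the start of \<open>q2\<close> sharpens the bound
          to \<open>length p2 + length q2 - 1\<close>, while \<open>?t\<close> has length m + n - 1.
          Hence both words must have maximal length.\<close>
        then have "length ?t \<le> length p2 + length q2'"
          by (rule length_keys_word_action) simp
        then have len: "length p2 = m" "length q2 = n"
          using le(1)[OF p2] le(2)[OF q2] p0(2) q0(2) P Q q2' by auto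
        obtain p3 x2 where p3: "p2 = p3 @ [x2]" "x2 \<in> arrow_letters" "letter_range E x2 = v"
          using snoc[OF p2 len(1)] by auto
        obtain q3 y2 where q3: "q2 = Vertex v # y2 # q3"
          using cons[OF q2 len(2)] by auto
        have "p3 = P \<and> q3 = Q \<and> leads_to x2 y2 x' y'"
        proof (rule ccontr)
          assume "\<not> ?thesis"
          then have "Poly_Mapping.lookup (word_action q2 (word p2)) ?t = (0 :: 'r)"
            unfolding p3(1) q3 using f(2)[OF p2] g(2)[OF q2] p3 q3 len p0(2) q0(2) P Q
            by (subst lookup_word_action_top) auto
          then show False using nz by simp
        qed
        then show ?thesis using uniq[of x2 y2] p2 q2 p3 q3 by auto
      qed
      ultimately show ?thesis using xy by blast
    qed
  qed
  then obtain p q t where pq: "p \<in> ?F" "q \<in> ?G"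
    and one: "Poly_Mapping.lookup (word_action q (word p)) t \<in> {1, - 1 :: 'r}"
    and uniq: "\<And>p2 q2. p2 \<in> ?F \<Longrightarrow> q2 \<in> ?G
      \<Longrightarrow> Poly_Mapping.lookup (word_action q2 (word p2)) t \<noteq> (0 :: 'r)
      \<Longrightarrow> p2 = p \<and> q2 = q"
    by blast
  let ?c = "\<lambda>(q, p). Poly_Mapping.lookup f p * Poly_Mapping.lookup g q * Poly_Mapping.lookup (word_action q (word p)) t"
  have "Poly_Mapping.lookup (action f g) t = (\<Sum>z\<in>{(q, p)}. ?c z)"
    unfolding lookup_action
  proof (rule sum.mono_neutral_right)
    show "\<forall>z\<in>?G \<times> ?F - {(q, p)}. ?c z = 0"
      using uniq by fastforce
  qed (use pq in auto)
  also have "\<dots> \<noteq> 0" using nz[OF pq] one by auto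
  finally show ?thesis by auto
qed

section \<open>Products through a vertex, and the conclusion\<close>

lemma vertex_elem_idempotent:
  assumes "v \<in> verts E"
  shows "vertex_elem v \<star> vertex_elem v - vertex_elem v \<in> leavitt_ideal E \<omega>"
  using leavitt_ideal_relation[OF leavitt_relations.vertices[OF assms assms]] by simp

text \<open>Both factors are replaced by combinations of normal words, obtained by acting on a
  vertex. The action of one on the other is nonzero by the leading coefficients, yet it would be
  zero if the product were in the ideal.\<close>

lemma leavitt_ideal_local_domain:
  fixes f g :: "('v, 'e) letter list \<Rightarrow>\<^sub>0 'r::ring_1_no_zero_divisors"
  assumes f: "f \<in> free_carrier (letters E \<omega>)" and g: "g \<in> free_carrier (letters E \<omega>)"
    and v: "v \<in> verts E"
    and fv: "f \<star> vertex_elem v \<notin> leavitt_ideal E \<omega>" and vg: "vertex_elem v \<star> g \<notin> leavitt_ideal E \<omega>"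
  shows "(f \<star> vertex_elem v) \<star> (vertex_elem v \<star> g) \<notin> leavitt_ideal E \<omega>"
proof
  let ?f = "f \<star> vertex_elem v" and ?g = "vertex_elem v \<star> g"
  assume fg: "?f \<star> ?g \<in> leavitt_ideal E \<omega>"
  have carr: "?f \<in> free_carrier (letters E \<omega>)" "?g \<in> free_carrier (letters E \<omega>)"
    using f g v by (auto intro: free_carrier_mult vertex_elem_in_carrier)
  \<comment> \<open>The action needs a normal word to start from, and a single vertex is the
    simplest; this one is chosen so that multiplying by it on the left does not bring
    \<open>?f\<close> into the ideal.\<close>
  obtain u where u: "u \<in> verts E" "vertex_elem u \<star> ?f \<notin> leavitt_ideal E \<omega>"
    using left_local_unit[OF carr(1) fv] by blast
  define A where "A = action (vertex_elem u) ?f"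
  define B where "B = action (vertex_elem v) ?g"
  have "vertex_elem u \<star> ?f - A \<in> leavitt_ideal E \<omega>"
    unfolding A_def using u carr by (intro action_cong) (auto simp: vertex_elem_def)
  then have A0: "A \<noteq> 0" using u by auto
  have A: "normal p \<and> letter_range E (last p) = v" if "p \<in> Poly_Mapping.keys A" for p
  proof -
    have "A = letter_action (Vertex v) (action (vertex_elem u) f)"
      by (simp add: A_def action_word_mult vertex_elem_def)
    then show ?thesis
      using that keys_letter_action_properties(1,2)[of p "Vertex v" "action (vertex_elem u) f"]
        by simp
  qed
  have "vertex_elem v \<star> ?g - B \<in> leavitt_ideal E \<omega>"
    unfolding B_def using v carr by (intro action_cong) (auto simp: vertex_elem_def)
  moreover have "(vertex_elem v \<star> vertex_elem v - vertex_elem v) \<star> g \<in> leavitt_ideal E \<omega>"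
    using vertex_elem_idempotent[OF v] g by (rule leavitt_ideal_mult_right)
  ultimately have
    "(vertex_elem v \<star> ?g - B) - (vertex_elem v \<star> vertex_elem v - vertex_elem v) \<star> g \<in> leavitt_ideal E \<omega>"
    by (rule leavitt_ideal_diff)
  \<comment> \<open>On this side the starting vertex is v, which is already a left unit of
    \<open>?g\<close> up to the ideal.\<close>
  then have gB: "?g - B \<in> leavitt_ideal E \<omega>"
    by (simp add: word_mult_diff_left word_mult_assoc)
  then have B0: "B \<noteq> 0" using vg by auto
  have B: "normal q \<and> hd q = Vertex v" if q: "q \<in> Poly_Mapping.keys B" for q
  proof -
    obtain w c where w:
      "q \<in> Poly_Mapping.keys (word_action w (word_scale_right (vertex_elem v) c)
        :: ('v, 'e) letter list \<Rightarrow>\<^sub>0 'r)"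
      using keys_action[OF q[unfolded B_def]] by blast
    have k: "p = [Vertex v]"
      if "p \<in> Poly_Mapping.keys (word_scale_right (vertex_elem v) c :: ('v, 'e) letter list \<Rightarrow>\<^sub>0 'r)"
        for p
      using that by (auto simp: vertex_elem_def split: if_splits)
    show ?thesis
      using keys_word_action_normal[OF w] hd_keys_word_action[OF w, of "Vertex v"] k v by fastforce
  qed
  \<comment> \<open>Both terms vanish: the first is the action of \<open>?f \<star> ?g\<close> on
    the vertex u, and \<open>?g - B\<close> lies in the ideal.\<close>
  have "action A B = action A ?g - action A (?g - B)"
    by (simp add: action_diff)
  also have "\<dots> = 0"
    using action_leavitt_ideal[OF gB, of A] action_leavitt_ideal[OF fg, of "vertex_elem u"]
    by (simp add: A_def action_word_mult)
  finally show False using action_nonzero[OF A0 A B0 B] by blast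
qed

lemma nonsingular_ring_weighted_leavitt_path_algebra:
  "nonsingular_ring (weighted_leavitt_path_algebra E \<omega> ::
     (('v, 'e) letter list \<Rightarrow>\<^sub>0 'r::ring_1_no_zero_divisors) set ring)"
proof -
  let ?F = "free_ring (letters E \<omega>) :: (('v, 'e) letter list \<Rightarrow>\<^sub>0 'r) ring"
  let ?I = "leavitt_ideal E \<omega> :: (('v, 'e) letter list \<Rightarrow>\<^sub>0 'r) set"
  interpret two_sided_ideal ?I ?F
    by (rule two_sided_ideal_free_ring) (rule free_ring_ideal_leavitt_ideal)
  interpret Q: nonunital_ring "?F Quot ?I"
    by (rule nonunital_ring_quotient)
  let ?c = "\<lambda>f. ?I +>\<^bsub>?F\<^esub> f"
  have V: "v \<in> verts E \<Longrightarrow> vertex_elem v \<in> carrier ?F" for v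
    by (rule vertex_elem_in_carrier)
  have mult: "?c f \<otimes>\<^bsub>?F Quot ?I\<^esub> ?c g = ?c (f \<star> g)" if "f \<in> carrier ?F" "g \<in> carrier ?F" for f g
    using quotient_simps(3)[OF that] by simp
  have zero: "?c f \<noteq> \<zero>\<^bsub>?F Quot ?I\<^esub> \<longleftrightarrow> f \<notin> ?I" if "f \<in> carrier ?F" for f
    using coset_eq_ideal_iff[OF that] by simp
  have "nonsingular_ring (?F Quot ?I)"
  proof (rule Q.nonsingular_ringI[where V = "(\<lambda>v. ?c (vertex_elem v)) ` verts E"])
    show "(\<lambda>v. ?c (vertex_elem v)) ` verts E \<subseteq> carrier (?F Quot ?I)"
      using V quotient_simps(1) by blast
    fix e assume "e \<in> (\<lambda>v. ?c (vertex_elem v)) ` verts E"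
    then obtain v where v: "v \<in> verts E" "e = ?c (vertex_elem v)" by blast
    have "vertex_elem v \<star> vertex_elem v - vertex_elem v \<in> ?I"
      by (rule vertex_elem_idempotent[OF v(1)])
    then have "?c (vertex_elem v \<star> vertex_elem v) = ?c (vertex_elem v)"
      using V[OF v(1)] free_carrier_mult[OF V[OF v(1)] V[OF v(1)]]
      by (intro a_repr_independence'[symmetric] a_rcos_module_rev) (auto simp: a_inv_free_ring)
    then show "e \<otimes>\<^bsub>?F Quot ?I\<^esub> e = e"
      using v V by (simp add: mult)
  next
    fix a assume "a \<in> carrier (?F Quot ?I)" "a \<noteq> \<zero>\<^bsub>?F Quot ?I\<^esub>"
    then obtain h where h: "h \<in> carrier ?F" "a = ?c h" "h \<notin> ?I"
      using zero by (metis quotient_carrierE)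
    obtain u where "u \<in> verts E" "h \<star> vertex_elem u \<notin> ?I" using right_local_unit[OF h(1,3)] by blast
    then show "\<exists>e\<in>(\<lambda>v. ?c (vertex_elem v)) ` verts E. a \<otimes>\<^bsub>?F Quot ?I\<^esub> e \<noteq> \<zero>\<^bsub>?F Quot ?I\<^esub>"
      using h V
        by (intro bexI[of _ "?c (vertex_elem u)"]) (auto simp only: mult zero free_carrier_mult)
    obtain u where "u \<in> verts E" "vertex_elem u \<star> h \<notin> ?I" using left_local_unit[OF h(1,3)] by blast
    then show "\<exists>e\<in>(\<lambda>v. ?c (vertex_elem v)) ` verts E. e \<otimes>\<^bsub>?F Quot ?I\<^esub> a \<noteq> \<zero>\<^bsub>?F Quot ?I\<^esub>"
      using h V
        by (intro bexI[of _ "?c (vertex_elem u)"]) (auto simp only: mult zero free_carrier_mult)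
  next
    fix a b e
    assume a: "a \<in> carrier (?F Quot ?I)" and b: "b \<in> carrier (?F Quot ?I)"
      and e: "e \<in> (\<lambda>v. ?c (vertex_elem v)) ` verts E"
      and nz: "a \<otimes>\<^bsub>?F Quot ?I\<^esub> e \<noteq> \<zero>\<^bsub>?F Quot ?I\<^esub>" "e \<otimes>\<^bsub>?F Quot ?I\<^esub> b \<noteq> \<zero>\<^bsub>?F Quot ?I\<^esub>"
    obtain f where f: "f \<in> carrier ?F" "a = ?c f" using a by (rule quotient_carrierE)
    obtain g where g: "g \<in> carrier ?F" "b = ?c g" using b by (rule quotient_carrierE)
    obtain v where v: "v \<in> verts E" "e = ?c (vertex_elem v)" using e by blast
    have carr: "f \<star> vertex_elem v \<in> carrier ?F" "vertex_elem v \<star> g \<in> carrier ?F"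
      using f g v V by (auto intro: free_carrier_mult)
    have "f \<star> vertex_elem v \<notin> ?I" "vertex_elem v \<star> g \<notin> ?I"
      using nz f g v V carr by (simp_all only: mult zero not_False_eq_True)
    then have "(f \<star> vertex_elem v) \<star> (vertex_elem v \<star> g) \<notin> ?I"
      by (rule leavitt_ideal_local_domain[OF f(1) g(1) v(1)])
    then show "(a \<otimes>\<^bsub>?F Quot ?I\<^esub> e) \<otimes>\<^bsub>?F Quot ?I\<^esub> (e \<otimes>\<^bsub>?F Quot ?I\<^esub> b) \<noteq> \<zero>\<^bsub>?F Quot ?I\<^esub>"
      using f g v V carr by (simp only: mult zero free_carrier_mult not_False_eq_True)
  qed
  then show ?thesis by (simp add: weighted_leavitt_path_algebra_def)
qed

end

theorem theorem47:
  fixes E :: "('v, 'e) pre_digraph" and \<omega> :: "'e \<Rightarrow> nat"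
  assumes "LV_graph E \<omega>"
  shows "nonsingular_ring (weighted_leavitt_path_algebra E \<omega> ::
           (('v, 'e) letter list \<Rightarrow>\<^sub>0 'r::ring_1_no_zero_divisors) set ring)"
proof -
  interpret LV_graph E \<omega> by (rule assms)
  show ?thesis by (rule nonsingular_ring_weighted_leavitt_path_algebra)
qed

end
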